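(* Let $k$ be a positive integer, $0\le\gamma<1$, and $\phi\in\mathcal{S}^*\left(\frac{k-1}{k}\right)$. Then every function in the class $\mathcal{KH}^{0}(k,\gamma)$ is close-to-convex in $\mathbb{E}$.
   Context: $\mathbb{E}=\{z\in\mathbb{C}:|z|<1\}$. $\mathcal{SH}^0$ is the class of univalent, sense-preserving harmonic functions $\mathfrak{f}=\mathfrak{u}+\overline{\mathfrak{v}}$ on $\mathbb{E}$, where $\mathfrak{u}(z)=z+\sum_{m=2}^\infty u_m z^m$ and $\mathfrak{v}(z)=\sum_{m=2}^\infty v_m z^m$ are analytic in $\mathbb{E}$. For $0\le\beta<1$, $\mathcal{S}^*(\beta)$ is the class of analytic functions $\phi(z)=z+\sum_{m=2}^\infty c_m z^m$ on $\mathbb{E}$ that are starlike of order $\beta$, i.e. $\mathrm{Re}\{z\phi'(z)/\phi(z)\}>\beta$ in $\mathbb{E}$. Given a positive integer $k$ and a fixed $\phi\in\mathcal{S}^*\left(\frac{k-1}{k}\right)$, put $\mu=e^{2\pi i/k}$ and $\phi_k(z)=\prod_{v=0}^{k-1}\mu^{-v}\phi(\mu^v z)$. For $0\le\gamma<1$, $\mathcal{KH}^0(k,\gamma)$ is the class of all $\mathfrak{f}=\mathfrak{u}+\overline{\mathfrak{v}}\in\mathcal{SH}^0$ satisfying, for all $z\in\mathbb{E}$, $$\mathrm{Re}\left\{\frac{z^k\mathfrak{u}'(z)}{\phi_k(z)}-\gamma\right\}>\left|\frac{z^k\mathfrak{v}'(z)}{\phi_k(z)}\right|$$ (the quotient $z^k/\phi_k(z)$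 has a removable singularity at $0$, with value $1$ there). A harmonic function $\mathfrak{f}$ is close-to-convex in $\mathbb{E}$ if it is univalent in $\mathbb{E}$ and $\mathfrak{f}(\mathbb{E})$ is a close-to-convex domain, i.e. the complement $\mathbb{C}\setminus\mathfrak{f}(\mathbb{E})$ is a union of closed half-lines whose corresponding open half-lines are pairwise disjoint. *)

theory Defs
  imports "HOL-Complex_Analysis.Complex_Analysis"
begin

abbreviation unit_disc :: "complex set" where
  "unit_disc \<equiv> ball 0 1"


section \<open>Starlike functions\<close>

text \<open>
  The normalization \<open>\<phi>(z) = z + c\<^sub>2 z\<^sup>2 + \<dots>\<close> is expressed by \<open>\<phi>(0) = 0\<close> and \<open>\<phi>'(0) = 1\<close>
  (see \<open>series_normalization\<close> below). The quotient \<open>z \<phi>'(z) / \<phi>(z)\<close> has a removable singularity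
  at 0 with value \<open>1 > \<beta>\<close>, so the condition is void there; since \<open>x / 0 = 0\<close> in HOL, the
  origin has to be left out explicitly.
\<close>

definition starlike_of_order :: "real \<Rightarrow> (complex \<Rightarrow> complex) set" where
  "starlike_of_order \<beta> =
     {\<phi>. \<phi> holomorphic_on unit_disc \<and> \<phi> 0 = 0 \<and> deriv \<phi> 0 = 1 \<and>
         (\<forall>z\<in>unit_disc - {0}. \<phi> z \<noteq> 0 \<and> Re (z * deriv \<phi> z / \<phi> z) > \<beta>)}"

definition root_mu :: "nat \<Rightarrow> complex" where
  "root_mu k = exp (2 * of_real pi * \<i> / of_nat k)"

definition phi_k :: "nat \<Rightarrow> (complex \<Rightarrow> complex) \<Rightarrow> complex \<Rightarrow> complex" where
  "phi_k k \<phi> z = (\<Prod>v<k. inverse (root_mu k ^ v) * \<phi> (root_mu k ^ v * z))"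

text \<open>\<open>z\<^sup>k / \<phi>\<^sub>k(z)\<close> with its removable singularity at 0 filled in (see \<open>tendsto_quot_k\<close> below).\<close>

definition quot_k :: "nat \<Rightarrow> (complex \<Rightarrow> complex) \<Rightarrow> complex \<Rightarrow> complex" where
  "quot_k k \<phi> z = (if z = 0 then 1 else z ^ k / phi_k k \<phi> z)"


section \<open>Harmonic functions\<close>

text \<open>
  Positive Jacobian: with \<open>f = p + \<i> q\<close> and real derivative \<open>D\<close>, we have
  \<open>D 1 = p\<^sub>x + \<i> q\<^sub>x\<close> and \<open>D \<i> = p\<^sub>y + \<i> q\<^sub>y\<close>, so the
  expression below is \<open>p\<^sub>x q\<^sub>y - q\<^sub>x p\<^sub>y\<close>.
\<close>

definition sense_preserving_on :: "(complex \<Rightarrow> complex) \<Rightarrow> complex set \<Rightarrow> bool" where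
  "sense_preserving_on f S \<longleftrightarrow>
     (\<forall>z\<in>S. \<exists>D. (f has_derivative D) (at z) \<and> Re (D 1) * Im (D \<i>) - Im (D 1) * Re (D \<i>) > 0)"

definition canonical_decomp ::
    "(complex \<Rightarrow> complex) \<Rightarrow> (complex \<Rightarrow> complex) \<Rightarrow> (complex \<Rightarrow> complex) \<Rightarrow> bool" where
  "canonical_decomp f u v \<longleftrightarrow>
     u holomorphic_on unit_disc \<and> u 0 = 0 \<and> deriv u 0 = 1 \<and>
     v holomorphic_on unit_disc \<and> v 0 = 0 \<and> deriv v 0 = 0 \<and>
     (\<forall>z\<in>unit_disc. f z = u z + cnj (v z))"

definition SH0 :: "(complex \<Rightarrow> complex) set" where
  "SH0 = {f. (\<exists>u v. canonical_decomp f u v) \<and> inj_on f unit_disc \<and>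
             sense_preserving_on f unit_disc}"

text \<open>On the disc, \<open>u\<close> and \<open>v\<close> are uniquely determined by \<open>f\<close>.\<close>

definition KH0 :: "nat \<Rightarrow> real \<Rightarrow> (complex \<Rightarrow> complex) \<Rightarrow> (complex \<Rightarrow> complex) set" where
  "KH0 k \<gamma> \<phi> =
     {f \<in> SH0. \<exists>u v. canonical_decomp f u v \<and>
        (\<forall>z\<in>unit_disc. Re (quot_k k \<phi> z * deriv u z - of_real \<gamma>)
                          > cmod (quot_k k \<phi> z * deriv v z))}"


section \<open>Close-to-convexity\<close>

definition closed_ray :: "complex \<Rightarrow> complex \<Rightarrow> complex set" where
  "closed_ray a d = {a + of_real t * d | t. t \<ge> 0}"

definition open_ray :: "complex \<Rightarrow> complex \<Rightarrow> complex set" where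
  "open_ray a d = {a + of_real t * d | t. t > 0}"

text \<open>
  A half-line is represented by its origin and its direction; directions are unit vectors,
  so that different pairs represent different half-lines.
\<close>

definition close_to_convex_domain :: "complex set \<Rightarrow> bool" where
  "close_to_convex_domain D \<longleftrightarrow>
     open D \<and> connected D \<and> D \<noteq> {} \<and>
     (\<exists>R. (\<forall>(a, d)\<in>R. norm d = 1) \<and>
          - D = (\<Union>(a, d)\<in>R. closed_ray a d) \<and>
          disjoint_family_on (\<lambda>(a, d). open_ray a d) R)"

definition close_to_convex :: "(complex \<Rightarrow> complex) \<Rightarrow> bool" where
  "close_to_convex f \<longleftrightarrow> inj_on f unit_disc \<and> close_to_convex_domain (f ` unit_disc)"


section \<open>Consistency of the encodings\<close>

lemma series_normalization:
  "(\<exists>c. c 0 = a \<and> c 1 = b \<and> (\<forall>z\<in>unit_disc. (\<lambda>m. c m * z ^ m) sums g z)) \<longleftrightarrow>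
     g holomorphic_on unit_disc \<and> g 0 = a \<and> deriv g 0 = b"
proof
  assume "\<exists>c. c 0 = a \<and> c 1 = b \<and> (\<forall>z\<in>unit_disc. (\<lambda>m. c m * z ^ m) sums g z)"
  then obtain c where c: "c 0 = a" "c 1 = b" "\<And>z. z \<in> unit_disc \<Longrightarrow> (\<lambda>m. c m * z ^ m) sums g z"
    by blast
  have hol: "g holomorphic_on unit_disc"
    by (rule power_series_holomorphic[of 0 1 c]) (use c in auto)
  have "(\<lambda>m. c m * 0 ^ m) sums c 0"
    using powser_sums_zero by blast
  moreover have "(\<lambda>m. c m * 0 ^ m) sums g 0"
    using c(3)[of 0] by simp
  ultimately have g0: "g 0 = c 0"
    using sums_unique2 by blast
  have "(deriv ^^ 1) g 0 = fact 1 * fps_nth (Abs_fps c) 1"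
  proof -
    have conv: "fps_conv_radius (Abs_fps c) \<ge> 1"
      unfolding fps_conv_radius_def
    proof (rule conv_radius_geI_ex)
      fix r :: real assume r: "0 < r" "ereal r < 1"
      then show "\<exists>z. norm z = r \<and> summable (\<lambda>n. fps_nth (Abs_fps c) n * z ^ n)"
        using c(3)[of "of_real r"] by (intro exI[of _ "of_real r"]) (auto simp: sums_iff)
    qed
    have "g has_fps_expansion Abs_fps c"
      unfolding has_fps_expansion_def
    proof
      show "0 < fps_conv_radius (Abs_fps c)"
        using conv by (rule less_le_trans[rotated]) simp
      show "\<forall>\<^sub>F z in nhds 0. eval_fps (Abs_fps c) z = g z"
        using eventually_nhds_in_open[of unit_disc "0 :: complex", simplified]
        by eventually_elim (use c(3) in \<open>auto simp: eval_fps_def sums_iff\<close>)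
    qed
    then show ?thesis
      using fps_nth_fps_expansion[of g "Abs_fps c" 1] by simp
  qed
  then show "g holomorphic_on unit_disc \<and> g 0 = a \<and> deriv g 0 = b"
    using hol g0 c by simp
next
  assume g: "g holomorphic_on unit_disc \<and> g 0 = a \<and> deriv g 0 = b"
  show "\<exists>c. c 0 = a \<and> c 1 = b \<and> (\<forall>z\<in>unit_disc. (\<lambda>m. c m * z ^ m) sums g z)"
    by (rule exI[of _ "\<lambda>n. (deriv ^^ n) g 0 / fact n"])
      (use g holomorphic_power_series[of g 0 1] in auto)
qed

lemma sense_preserving_canonical_iff:
  assumes "canonical_decomp f u v"
  shows "sense_preserving_on f unit_disc \<longleftrightarrow> (\<forall>z\<in>unit_disc. cmod (deriv v z) < cmod (deriv u z))"
  unfolding sense_preserving_on_def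
proof (rule ball_cong[OF refl])
  fix z assume z: "z \<in> unit_disc"
  define D where "D = (\<lambda>h. deriv u z * h + cnj (deriv v z * h))"
  have "(u has_field_derivative deriv u z) (at z)" "(v has_field_derivative deriv v z) (at z)"
    using assms z holomorphic_derivI[OF _ open_ball] unfolding canonical_decomp_def by blast+
  then have "((\<lambda>z. u z + cnj (v z)) has_derivative D) (at z)"
    unfolding D_def has_field_derivative_def
    by (intro has_derivative_add bounded_linear.has_derivative[OF bounded_linear_cnj]) auto
  then have D: "(f has_derivative D) (at z)"
    by (rule has_derivative_transform_within_open[OF _ open_ball z])
      (use assms in \<open>simp add: canonical_decomp_def\<close>)
  have "Re (D 1) * Im (D \<i>) - Im (D 1) * Re (D \<i>) = (cmod (deriv u z))\<^sup>2 - (cmod (deriv v z))\<^sup>2"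
    by (simp only: cmod_power2) (simp add: D_def algebra_simps power2_eq_square)
  moreover have "(cmod (deriv v z))\<^sup>2 < (cmod (deriv u z))\<^sup>2 \<longleftrightarrow> cmod (deriv v z) < cmod (deriv u z)"
    using power_strict_mono[of "cmod (deriv v z)" "cmod (deriv u z)" 2]
      power_less_imp_less_base[of "cmod (deriv v z)" 2 "cmod (deriv u z)"] by auto
  ultimately show "(\<exists>D. (f has_derivative D) (at z) \<and> Re (D 1) * Im (D \<i>) - Im (D 1) * Re (D \<i>) > 0) \<longleftrightarrow>
      cmod (deriv v z) < cmod (deriv u z)"
    using D has_derivative_unique[OF D] by (metis diff_gt_0_iff_gt)
qed

lemma tendsto_quot_k:
  assumes "\<phi> \<in> starlike_of_order \<beta>" "k > 0"
  shows "((\<lambda>z. z ^ k / phi_k k \<phi> z) \<longlongrightarrow> 1) (at 0)"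
proof -
  have "(\<phi> has_field_derivative 1) (at 0)"
    using assms holomorphic_derivI[of \<phi> unit_disc 0] by (auto simp: starlike_of_order_def)
  then have lim: "((\<lambda>z. \<phi> z / z) \<longlongrightarrow> 1) (at 0)"
    using assms by (simp add: DERIV_def starlike_of_order_def)
  have nz: "root_mu k ^ v \<noteq> 0" for v
    by (simp add: root_mu_def)
  have "((\<lambda>z. \<Prod>v<k. \<phi> (root_mu k ^ v * z) / (root_mu k ^ v * z)) \<longlongrightarrow> (\<Prod>v<k. 1)) (at 0)"
  proof (rule tendsto_prod)
    fix v
    have "filterlim (\<lambda>z. root_mu k ^ v * z) (at 0) (at 0)"
      by (rule filterlim_atI) (auto intro!: tendsto_eq_intros eventually_at_filter[THEN iffD2] simp: nz root_mu_def)
    then show "((\<lambda>z. \<phi> (root_mu k ^ v * z) / (root_mu k ^ v * z)) \<longlongrightarrow> 1) (at 0)"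
      using lim filterlim_compose by blast
  qed
  then have "((\<lambda>z. inverse (\<Prod>v<k. \<phi> (root_mu k ^ v * z) / (root_mu k ^ v * z))) \<longlongrightarrow> 1) (at 0)"
    using tendsto_inverse by fastforce
  moreover have "inverse (\<Prod>v<k. \<phi> (root_mu k ^ v * z) / (root_mu k ^ v * z)) = z ^ k / phi_k k \<phi> z" for z
    by (simp add: phi_k_def prod_dividef prod.distrib prod_inversef field_simps)
  ultimately show ?thesis
    by simp
qed

end

theory Submission
  imports Defs
begin

text \<open>
  The function \<open>\<phi>\<^sub>k(z) / z\<^sup>k\<^sup>-\<^sup>1\<close> is starlike, so it can be written as \<open>z g'(z)\<close>, where \<open>g\<close> is univalent
  and maps every disc around 0 onto a convex set. In terms of \<open>g\<close>, the defining condition of the class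
  implies \<open>Re (u' / g') > \<bar>v' / g'\<bar>\<close>. This says that \<open>F = f \<circ> g\<^sup>-\<^sup>1\<close>, a function on the convex range
  of \<open>g\<close>, has a derivative with positive definite symmetric part; integration along segments shows that
  \<open>F\<close> is strictly monotone in the sense of Minty: \<open>inner (F a - F b) (a - b) > 0\<close> for \<open>a \<noteq> b\<close>
  (\<open>strictly_monotone_transplant\<close>).

  The half-lines come from the theory of monotone operators. If \<open>F\<close> is continuous and strictly monotone
  on a compact convex set \<open>K\<close>, every point \<open>w\<close> of the plane can be written in exactly one way as
  \<open>F p + n\<close> with \<open>p \<in> K\<close> and \<open>n\<close> an outward normal of \<open>K\<close> at \<open>p\<close>
  (\<open>ex1_normal_decomposition\<close>). The points with \<open>n = 0\<close> form the image of \<open>K\<close>, and the remaining ones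
  are swept out by the half-lines \<open>F p + t n\<close> for \<open>t > 0\<close>. By uniqueness these do not cross, and
  their direction depends continuously on \<open>w\<close> (\<open>ray_field_of_strictly_monotone\<close>).

  Let \<open>K\<close> run through the images under \<open>g\<close> of closed discs that exhaust the unit disc. At each point
  outside \<open>f ` unit_disc\<close> the directions have a cluster point, which defines a half-line in the complement
  of \<open>f ` unit_disc\<close> (\<open>half_line_field_limit\<close>). The limits do not cross transversally, since such
  crossings are stable under small perturbations. Two limits cannot face each other on a line either: this would
  make the continuous approximating direction reverse along the segment between them, and a half-line
  perpendicular to the segment would be in the way (\<open>ray_field_no_facing_rays\<close>). So limits that meet
  have the same direction, and merging them gives the required family (\<open>half_lines_of_field\<close>).
\<close>

section \<open>Strictly monotone maps on compact convex sets\<close>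

definition strictly_monotone_on :: "'a::real_inner set \<Rightarrow> ('a \<Rightarrow> 'a) \<Rightarrow> bool" where
  "strictly_monotone_on K F \<longleftrightarrow> (\<forall>a\<in>K. \<forall>b\<in>K. a \<noteq> b \<longrightarrow> inner (F a - F b) (a - b) > 0)"

definition normal_cone :: "'a::real_inner set \<Rightarrow> 'a \<Rightarrow> 'a set" where
  "normal_cone K p = {n. \<forall>y\<in>K. inner n (y - p) \<le> 0}"

text \<open>
  A continuous choice, for every point outside \<open>C\<close>, of a half-line that avoids \<open>C\<close>. The condition
  that the direction is constant along each half-line makes the half-lines non-crossing: two of
  them that share a point have the same direction there, so one contains the other.
\<close>
definition is_ray_field :: "'a::real_normed_vector set \<Rightarrow> ('a \<Rightarrow> 'a) \<Rightarrow> bool" where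
  "is_ray_field C e \<longleftrightarrow> continuous_on (- C) e \<and>
     (\<forall>w\<in>-C. norm (e w) = 1 \<and> (\<forall>s\<ge>0. w + s *\<^sub>R e w \<in> - C \<and> e (w + s *\<^sub>R e w) = e w))"

lemma normal_cone_scaleR: "n \<in> normal_cone K p \<Longrightarrow> 0 \<le> c \<Longrightarrow> c *\<^sub>R n \<in> normal_cone K p"
  by (auto simp: normal_cone_def mult_nonneg_nonpos)

text \<open>
  This is the Hartman--Stampacchia theorem, in the form that the set-valued map \<open>F + N\<^sub>K\<close>
  attains every value at exactly one point. A point \<open>p\<close> has the required property exactly when it is the point of \<open>K\<close> closest to
  \<open>p + (w - F p)\<close>, so Brouwer's theorem yields one; two different solutions \<open>p\<close> and \<open>q\<close> would satisfy
  \<open>inner (F p - F q) (p - q) \<le> 0\<close>.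
\<close>
lemma ex1_normal_decomposition:
  fixes F :: "'a::euclidean_space \<Rightarrow> 'a"
  assumes K: "compact K" "convex K" "K \<noteq> {}"
    and F: "continuous_on K F" "strictly_monotone_on K F"
  shows "\<exists>!p. p \<in> K \<and> w - F p \<in> normal_cone K p"
proof -
  have "\<exists>p. p \<in> K \<and> w - F p \<in> normal_cone K p"
  proof -
    have "continuous_on K (\<lambda>p. closest_point K (p + (w - F p)))"
      by (rule continuous_on_compose2[OF continuous_on_closest_point[of K UNIV]])
        (use K F in \<open>auto intro!: continuous_intros compact_imp_closed\<close>)
    moreover have "(\<lambda>p. closest_point K (p + (w - F p))) \<in> K \<rightarrow> K"
      using K by (auto intro!: closest_point_in_set compact_imp_closed)
    ultimately obtain p where p: "p \<in> K" "closest_point K (p + (w - F p)) = p"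
      by (rule brouwer[OF K])
    have "w - F p \<in> normal_cone K p"
      unfolding normal_cone_def
      using closest_point_dot[of K _ "p + (w - F p)"] K p compact_imp_closed by auto
    then show ?thesis
      using p by blast
  qed
  moreover have "p = q" if "p \<in> K" "w - F p \<in> normal_cone K p" "q \<in> K" "w - F q \<in> normal_cone K q" for p q
  proof (rule ccontr)
    assume "p \<noteq> q"
    then have "inner (F p - F q) (p - q) > 0"
      using that F unfolding strictly_monotone_on_def by blast
    moreover have "inner (w - F p) (q - p) \<le> 0" "inner (w - F q) (p - q) \<le> 0"
      using that unfolding normal_cone_def by auto
    ultimately show False
      by (simp add: inner_diff_left inner_diff_right)
  qed
  ultimately show ?thesis
    by blast
qed

text \<open>
  Write \<open>w = F p + n\<close> with \<open>n\<close> in the normal cone at \<open>p\<close>. If \<open>w\<close> lies outside \<open>F ` K\<close>, then \<open>n\<close> is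
  nonzero, and for all \<open>s \<ge> 0\<close> the decomposition of \<open>w + s n\<close> has the same \<open>p\<close> and the normal vector
  \<open>(1 + s) n\<close>. Hence the direction of \<open>n\<close> is constant along the half-line, and the half-line never
  returns to \<open>F ` K\<close>, whose points have decompositions with normal vector 0. Continuity holds because
  \<open>p\<close> depends on \<open>w\<close> through a closed graph with values in a compact set.
\<close>
lemma ray_field_of_strictly_monotone:
  fixes F :: "'a::euclidean_space \<Rightarrow> 'a"
  assumes K: "compact K" "convex K" "K \<noteq> {}"
    and F: "continuous_on K F" "strictly_monotone_on K F"
  shows "\<exists>e. is_ray_field (F ` K) e"
proof -
  have "\<forall>w. \<exists>p. p \<in> K \<and> w - F p \<in> normal_cone K p"
    using ex1_normal_decomposition[OF assms] by blast
  then obtain P where P: "\<And>w. P w \<in> K" "\<And>w. w - F (P w) \<in> normal_cone K (P w)"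
    by metis
  have P_eq: "P w = p" if "p \<in> K" "w - F p \<in> normal_cone K p" for w p
    using ex1_normal_decomposition[OF assms, of w] P[of w] that by blast
  have contP: "continuous_on UNIV P"
  proof (rule continuous_from_closed_graph[OF K(1)])
    have "((\<lambda>x. (x, P x)) ` UNIV) =
      (\<Inter>y\<in>K. {x \<in> UNIV \<times> K. inner (fst x - F (snd x)) (y - snd x) \<in> {..0}})"
    proof (intro equalityI subsetI)
      fix x assume "x \<in> (\<lambda>x. (x, P x)) ` UNIV"
      then show "x \<in> (\<Inter>y\<in>K. {x \<in> UNIV \<times> K. inner (fst x - F (snd x)) (y - snd x) \<in> {..0}})"
        using P by (auto simp: normal_cone_def)
    next
      fix x assume "x \<in> (\<Inter>y\<in>K. {x \<in> UNIV \<times> K. inner (fst x - F (snd x)) (y - snd x) \<in> {..0}})"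
      then have "snd x \<in> K" "fst x - F (snd x) \<in> normal_cone K (snd x)"
        using K(3) by (auto simp: normal_cone_def)
      then have "P (fst x) = snd x"
        by (rule P_eq)
      then show "x \<in> (\<lambda>x. (x, P x)) ` UNIV"
        by (intro image_eqI[of _ _ "fst x"]) (auto simp: prod_eq_iff)
    qed
    moreover have "closed {x \<in> UNIV \<times> K. inner (fst x - F (snd x)) (y - snd x) \<in> {..0}}" for y
    proof (rule continuous_closed_preimage[unfolded vimage_def Int_def mem_Collect_eq])
      have "continuous_on (UNIV \<times> K) (\<lambda>x. F (snd x))"
        by (rule continuous_on_compose2[OF F(1)]) (auto intro!: continuous_intros)
      then show "continuous_on (UNIV \<times> K) (\<lambda>x. inner (fst x - F (snd x)) (y - snd x))"
        by (intro continuous_intros)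
    qed (use compact_imp_closed[OF K(1)] in \<open>auto simp: closed_Times\<close>)
    ultimately show "closed ((\<lambda>x. (x, P x)) ` UNIV)"
      by auto
  qed (use P in auto)
  define N where "N = (\<lambda>w. w - F (P w))"
  define e where "e = (\<lambda>w. sgn (N w))"
  have Nz: "N w \<noteq> 0" if "w \<in> - (F ` K)" for w
    using that P(1)[of w] by (auto simp: N_def)
  have "continuous_on UNIV N"
    unfolding N_def
    by (intro continuous_intros continuous_on_compose2[OF F(1) contP]) (use P in auto)
  then have "continuous_on (- (F ` K)) e"
    unfolding e_def using Nz by (intro continuous_on_sgn) (auto intro: continuous_on_subset)
  moreover have "norm (e w) = 1 \<and> (\<forall>s\<ge>0. w + s *\<^sub>R e w \<in> - F ` K \<and> e (w + s *\<^sub>R e w) = e w)"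
    if w: "w \<in> - F ` K" for w
  proof (intro conjI allI impI)
    show "norm (e w) = 1"
      using Nz[OF w] by (simp add: e_def norm_sgn)
    fix s :: real assume s: "s \<ge> 0"
    define c where "c = 1 + s / norm (N w)"
    have c: "c \<ge> 1"
      using s by (simp add: c_def)
    have eq: "w + s *\<^sub>R e w - F (P w) = c *\<^sub>R N w"
      by (simp add: c_def N_def e_def sgn_div_norm scaleR_left_distrib divide_inverse algebra_simps)
    have Pc: "P (w + s *\<^sub>R e w) = P w"
      by (rule P_eq) (use P c in \<open>auto simp: eq N_def intro: normal_cone_scaleR\<close>)
    then have "N (w + s *\<^sub>R e w) = c *\<^sub>R N w"
      using eq by (simp add: N_def)
    then show "e (w + s *\<^sub>R e w) = e w"
      using c by (simp add: e_def sgn_scaleR)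
    show "w + s *\<^sub>R e w \<in> - F ` K"
    proof
      assume "w + s *\<^sub>R e w \<in> F ` K"
      then obtain p where p: "p \<in> K" "w + s *\<^sub>R e w = F p"
        by auto
      then have "P (w + s *\<^sub>R e w) = p"
        by (intro P_eq) (auto simp: normal_cone_def)
      then show False
        using Pc p eq Nz[OF w] c by auto
    qed
  qed
  ultimately show ?thesis
    unfolding is_ray_field_def by blast
qed

section \<open>Half-lines of a ray field do not cross\<close>

definition cross :: "complex \<Rightarrow> complex \<Rightarrow> real" where
  "cross a b = Im (cnj a * b)"

lemma cross_eq: "cross a b = Re a * Im b - Im a * Re b"
  by (simp add: cross_def)

text \<open>
  Cramer's rule for the intersection of two lines.
\<close>
lemma rays_meet:
  assumes "cross a b \<noteq> 0"
  shows "w + of_real (cross (w' - w) b / cross a b) * a = w' + of_real (cross (w' - w) a / cross a b) * b"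
proof -
  have "of_real (cross (w' - w) b) * a - of_real (cross (w' - w) a) * b = (w' - w) * of_real (cross a b)"
    by (simp add: cross_eq complex_eq_iff algebra_simps)
  then show ?thesis
    using assms by (simp add: field_simps)
qed

lemma ray_field_no_crossing:
  assumes e: "is_ray_field C e" and w: "w \<notin> C" "w' \<notin> C"
    and "cross (e w) (e w') \<noteq> 0"
  shows "\<not> (cross (w' - w) (e w') / cross (e w) (e w') \<ge> 0 \<and> cross (w' - w) (e w) / cross (e w) (e w') \<ge> 0)"
proof
  assume *: "cross (w' - w) (e w') / cross (e w) (e w') \<ge> 0 \<and> cross (w' - w) (e w) / cross (e w) (e w') \<ge> 0"
  have along: "e (v + of_real s * e v) = e v" if "v \<notin> C" "s \<ge> 0" for v s
    using e that unfolding is_ray_field_def scaleR_conv_of_real by blast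
  have "e w = e w'"
    using along[OF w(1)] along[OF w(2)] * rays_meet[OF assms(4), of w w'] by metis
  with assms(4) show False
    by (simp add: cross_eq)
qed

text \<open>
  Turn the picture such that \<open>\<delta> = 1\<close>. The direction of the field turns continuously along the segment
  from \<open>w\<close> to \<open>w + L\<close>, from one that points to the right to one that points to the left, so
  somewhere between it is vertical, say upwards. That vertical half-line is hit by any of the two outer
  half-lines that does not descend. But if both of them descend, they hit each other.
\<close>
lemma ray_field_no_facing_rays:
  assumes e: "is_ray_field C e" and L: "L > 0" and \<delta>: "norm \<delta> = 1"
    and seg: "\<And>t. 0 \<le> t \<Longrightarrow> t \<le> L \<Longrightarrow> w + of_real t * \<delta> \<notin> C"
    and Re: "Re (cnj \<delta> * e w) > 0" "Re (cnj \<delta> * e (w + of_real L * \<delta>)) < 0"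
  shows False
proof -
  \<comment> \<open>\<open>x\<close> runs along the segment, and \<open>c\<close> is the direction of the field in coordinates where \<open>\<delta> = 1\<close>.\<close>
  define x where "x = (\<lambda>t. w + of_real t * \<delta>)"
  define c where "c = (\<lambda>t. cnj \<delta> * e (x t))"
  have x: "x t \<notin> C" if "0 \<le> t" "t \<le> L" for t
    using seg that by (simp add: x_def)
  have unit: "\<delta> * cnj \<delta> = 1"
    using \<delta> complex_norm_square[of \<delta>] by simp
  have cross_rot: "cross (cnj \<delta> * a) (cnj \<delta> * b) = cross a b" for a b
  proof -
    have "cnj (cnj \<delta> * a) * (cnj \<delta> * b) = (\<delta> * cnj \<delta>) * (cnj a * b)"
      by (simp add: algebra_simps)
    then show ?thesis
      by (simp only: cross_def unit mult_1_left)
  qed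
  have "continuous_on {0..L} (\<lambda>t. Re (c t))"
  proof -
    have "continuous_on {0..L} (\<lambda>t. e (x t))"
      by (rule continuous_on_compose2[of "- C" e])
        (use e x in \<open>auto simp: is_ray_field_def x_def intro!: continuous_intros\<close>)
    then show ?thesis
      unfolding c_def by (intro continuous_intros)
  qed
  then obtain t where t: "0 \<le> t" "t \<le> L" "Re (c t) = 0"
    using IVT2'[of "\<lambda>t. Re (c t)" L 0 0] Re L by (auto simp: c_def x_def)
  have norm1: "norm (c s) = 1" if "0 \<le> s" "s \<le> L" for s
    using e x[OF that] \<delta> by (simp add: c_def is_ray_field_def norm_mult)
  have no: "\<not> ((s' - s) * Im (c s') / cross (c s) (c s') \<ge> 0 \<and> (s' - s) * Im (c s) / cross (c s) (c s') \<ge> 0)"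
    if "0 \<le> s" "s \<le> L" "0 \<le> s'" "s' \<le> L" "cross (c s) (c s') \<noteq> 0" for s s'
  proof -
    have "cross (x s' - x s) v = (s' - s) * Im (cnj \<delta> * v)" for v
    proof -
      have "cross (x s' - x s) v = cross (of_real (s' - s) * \<delta>) v"
        by (simp add: x_def algebra_simps)
      also have "\<dots> = (s' - s) * Im (cnj \<delta> * v)"
        by (simp add: cross_def algebra_simps)
      finally show ?thesis .
    qed
    then show ?thesis
      using ray_field_no_crossing[OF e x x, of s s'] that by (simp add: c_def cross_rot)
  qed
  define p q where "p = Im (c 0)" and "q = Im (c L)"
  define a b where "a = Re (c 0)" and "b = Re (c L)"
  have ab: "a > 0" "b < 0"
    using Re by (simp_all add: a_def b_def c_def x_def)
  have "\<bar>Im (c t)\<bar> = 1"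
    using norm1[OF t(1,2)] t(3) by (simp add: cmod_def)
  then consider "Im (c t) = 1" | "Im (c t) = -1"
    by linarith
  \<comment> \<open>Each case compares the outer half-lines with the vertical one at \<open>x t\<close>, upward or downward.\<close>
  then have "p < 0 \<and> q < 0 \<or> p > 0 \<and> q > 0"
  proof cases
    case 1
    have "\<not> (t * 1 / a \<ge> 0 \<and> t * p / a \<ge> 0)"
      using no[of 0 t] t L ab 1 by (simp add: cross_eq a_def p_def)
    moreover have "\<not> ((t - L) * 1 / b \<ge> 0 \<and> (t - L) * q / b \<ge> 0)"
      using no[of L t] t L ab 1 by (simp add: cross_eq b_def q_def)
    ultimately show ?thesis
      using t ab by (auto simp: zero_le_divide_iff zero_le_mult_iff mult_le_0_iff divide_le_0_iff)
  next
    case 2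
    have "\<not> (t * (-1) / - a \<ge> 0 \<and> t * p / - a \<ge> 0)"
      using no[of 0 t] t L ab 2 by (simp add: cross_eq a_def p_def)
    moreover have "\<not> ((t - L) * (-1) / - b \<ge> 0 \<and> (t - L) * q / - b \<ge> 0)"
      using no[of L t] t L ab 2 by (simp add: cross_eq b_def q_def)
    ultimately show ?thesis
      using t ab by (auto simp: zero_le_divide_iff zero_le_mult_iff mult_le_0_iff divide_le_0_iff)
  qed
  moreover have "\<not> (a * q - p * b \<noteq> 0 \<and> L * q / (a * q - p * b) \<ge> 0 \<and> L * p / (a * q - p * b) \<ge> 0)"
    using no[of 0 L] L unfolding cross_eq a_def b_def p_def q_def by auto
  moreover have "a * q - p * b < 0" if "p < 0" "q < 0"
    using that ab mult_pos_neg[of a q] mult_neg_neg[of p b] by linarith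
  moreover have "a * q - p * b > 0" if "p > 0" "q > 0"
    using that ab mult_pos_pos[of a q] mult_pos_neg[of p b] by linarith
  ultimately show False
    using L by (auto simp: zero_le_divide_iff zero_le_mult_iff mult_le_0_iff)
qed

section \<open>Limits of ray fields\<close>

text \<open>
  What survives of the ray fields in the limit. Different half-lines may now touch, or overlap in the
  same direction, so the direction need not be constant along a half-line.
\<close>
definition is_half_line_field :: "complex set \<Rightarrow> (complex \<Rightarrow> complex) \<Rightarrow> bool" where
  "is_half_line_field A d \<longleftrightarrow>
     (\<forall>w\<in>A. norm (d w) = 1 \<and> closed_ray w (d w) \<subseteq> A) \<and>
     (\<forall>w\<in>A. \<forall>w'\<in>A. open_ray w (d w) \<inter> open_ray w' (d w') \<noteq> {} \<longrightarrow> d w = d w')"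

text \<open>
  Tychonoff's theorem replaces the choice of a convergent subsequence, which would only serve countably
  many points at a time. Frequent closeness at two points simultaneously is all that is needed to
  compare two half-lines.
\<close>
lemma pointwise_cluster_function:
  fixes e :: "nat \<Rightarrow> 'a \<Rightarrow> 'b::topological_space"
  assumes "compact S" "\<And>n x. e n x \<in> S"
  obtains d where "\<And>x. d x \<in> S"
    and "\<And>x y U N. open U \<Longrightarrow> (d x, d y) \<in> U \<Longrightarrow> \<exists>n\<ge>N. (e n x, e n y) \<in> U"
proof -
  have "compact (PiE UNIV (\<lambda>_::'a. S))"
    using assms(1) compactin_PiE[of "\<lambda>_. euclidean" UNIV "\<lambda>_::'a. S"]
    by (simp add: euclidean_product_topology)
  then obtain d where d: "d \<in> PiE UNIV (\<lambda>_. S)" "inf (nhds d) (filtermap e sequentially) \<noteq> bot"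
    unfolding compact_filter
    using assms(2) by (metis (mono_tags, lifting) PiE_UNIV_domain PiE_I UNIV_I always_eventually
        eventually_filtermap filtermap_bot_iff trivial_limit_sequentially)
  have "\<exists>n\<ge>N. (e n x, e n y) \<in> U" if U: "open U" "(d x, d y) \<in> U" for x y U and N :: nat
  proof (rule ccontr)
    assume *: "\<not> ?thesis"
    let ?V = "(\<lambda>f. (f x, f y)) -` U"
    have "continuous_on UNIV (\<lambda>f::'a \<Rightarrow> 'b. (f x, f y))"
      by (intro continuous_on_Pair continuous_on_product_coordinates)
    then have "open ?V"
      using U(1) by (simp add: continuous_on_open_vimage)
    then have "eventually (\<lambda>f. f \<in> ?V) (nhds d)"
      using U(2) by (intro eventually_nhds_in_open) auto
    moreover have "eventually (\<lambda>f. f \<notin> ?V) (filtermap e sequentially)"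
      unfolding eventually_filtermap eventually_sequentially using * by auto
    ultimately have "eventually (\<lambda>_. False) (inf (nhds d) (filtermap e sequentially))"
      unfolding eventually_inf by blast
    then show False
      using d(2) by (simp add: trivial_limit_def)
  qed
  with d(1) show thesis
    by (intro that[of d]) auto
qed

lemma open_rayE:
  assumes "z \<in> open_ray a d" obtains s where "s > 0" "z = a + of_real s * d"
  using assms by (auto simp: open_ray_def)

text \<open>
  The direction \<open>d w\<close> is a cluster point of the directions \<open>e n w\<close>. A limit half-line
  cannot enter \<open>D\<close>, because a neighbourhood of each point of \<open>D\<close> is eventually inside \<open>C n\<close>. Suppose that two limits cross. Transversal half-lines still
  cross after a small perturbation, so they would cross for some \<open>n\<close>. If their
  directions are opposite, they face each other along a segment of the complement, which
  \<open>ray_field_no_facing_rays\<close> excludes for some \<open>n\<close>.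
\<close>
lemma half_line_field_limit:
  fixes C :: "nat \<Rightarrow> complex set"
  assumes e: "\<And>n. is_ray_field (C n) (e n)"
    and sub: "\<And>n. C n \<subseteq> D"
    and exh: "\<And>x. x \<in> D \<Longrightarrow> \<exists>\<delta>>0. \<exists>N. \<forall>n\<ge>N. ball x \<delta> \<subseteq> C n"
  shows "\<exists>d. is_half_line_field (- D) d"
proof -
  \<comment> \<open>Inside \<open>D\<close> the directions are arbitrary; they are fixed only to get values on the unit circle.\<close>
  define e' where "e' = (\<lambda>n w. if w \<in> D then 1 else e n w)"
  have "e' n w \<in> sphere 0 1" for n w
    using e[of n] sub[of n] by (auto simp: e'_def is_ray_field_def)
  then obtain d where d: "\<And>w. d w \<in> sphere 0 1"
    and clust': "\<And>x y U N. open U \<Longrightarrow> (d x, d y) \<in> U \<Longrightarrow> \<exists>n\<ge>N. (e' n x, e' n y) \<in> U"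
    using pointwise_cluster_function[of "sphere 0 1" e'] by (metis compact_sphere)
  have clust: "\<exists>n\<ge>N. (e n x, e n y) \<in> U" if "open U" "(d x, d y) \<in> U" "x \<notin> D" "y \<notin> D" for x y U N
    using clust'[OF that(1,2), of N] that by (auto simp: e'_def)
  have norm_d: "norm (d w) = 1" for w
    using d[of w] by simp
  have ray: "w + of_real s * d w \<notin> D" if w: "w \<notin> D" and s: "s \<ge> 0" for w s
  proof
    assume "w + of_real s * d w \<in> D"
    then obtain \<delta> N where \<delta>: "\<delta> > 0" "\<And>n. n \<ge> N \<Longrightarrow> ball (w + of_real s * d w) \<delta> \<subseteq> C n"
      using exh by blast
    let ?U = "(\<lambda>p::complex \<times> complex. w + of_real s * fst p) -` ball (w + of_real s * d w) \<delta>"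
    have "continuous_on UNIV (\<lambda>p::complex \<times> complex. w + of_real s * fst p)"
      by (intro continuous_intros)
    then have "open ?U"
      by (intro open_vimage open_ball)
    moreover have "(d w, d w) \<in> ?U"
      using \<delta>(1) by simp
    ultimately obtain n where n: "n \<ge> N" "(e n w, e n w) \<in> ?U"
      using clust[of ?U w w N] w by metis
    then have "w + of_real s * e n w \<in> ball (w + of_real s * d w) \<delta>"
      by simp
    then have "w + of_real s * e n w \<in> C n"
      using \<delta>(2)[OF n(1)] by blast
    moreover have "w + of_real s * e n w \<notin> C n"
      using e[of n] sub[of n] w s unfolding is_ray_field_def scaleR_conv_of_real by blast
    ultimately show False
      by blast
  qed
  have "d w = d w'" if w: "w \<notin> D" "w' \<notin> D" and z: "z \<in> open_ray w (d w)" "z \<in> open_ray w' (d w')" for w w' z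
  proof -
    obtain s where s: "s > 0" "z = w + of_real s * d w"
      using z(1) by (rule open_rayE)
    obtain s' where s': "s' > 0" "z = w' + of_real s' * d w'"
      using z(2) by (rule open_rayE)
    have eq: "w' - w = of_real s * d w - of_real s' * d w'"
      using s s' by (simp add: algebra_simps)
    have par: "cross (d w) (d w') = 0"
    proof (rule ccontr)
      assume nz: "cross (d w) (d w') \<noteq> 0"
      \<comment> \<open>By Cramer's rule, the pairs of directions in \<open>U\<close> belong to half-lines from \<open>w\<close> and \<open>w'\<close> that cross.\<close>
      define U where "U = {p. cross (fst p) (snd p) * cross (d w) (d w') > 0 \<and>
        cross (w' - w) (snd p) * cross (d w) (d w') > 0 \<and> cross (w' - w) (fst p) * cross (d w) (d w') > 0}"
      have "open U"
        unfolding U_def cross_def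
        by (intro open_Collect_conj open_Collect_less continuous_intros)
      moreover have "cross (w' - w) (d w') = s * cross (d w) (d w')" "cross (w' - w) (d w) = s' * cross (d w) (d w')"
        by (simp_all add: eq cross_eq algebra_simps)
      then have "(d w, d w') \<in> U"
        using nz s(1) s'(1) by (auto simp: U_def zero_less_mult_iff mult_less_0_iff linorder_neq_iff)
      ultimately obtain n where "(e n w, e n w') \<in> U"
        using clust w by blast
      moreover have "w \<notin> C n" "w' \<notin> C n"
        using w sub[of n] by auto
      ultimately show False
        using ray_field_no_crossing[OF e[of n], of w w']
        by (auto simp: U_def zero_less_mult_iff zero_le_divide_iff)
    qed
    have "d w' = d w \<or> d w' = - d w"
    proof -
      have "cnj (d w) * d w' \<in> \<real>"
        using par by (simp add: cross_def complex_is_Real_iff)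
      then obtain r where r: "cnj (d w) * d w' = of_real r"
        by (auto elim: Reals_cases)
      moreover have "\<bar>r\<bar> = 1"
        using arg_cong[OF r, of norm] by (simp add: norm_mult norm_d)
      moreover have "d w' = d w * (cnj (d w) * d w')"
        using complex_norm_square[of "d w"] by (simp add: norm_d flip: mult.assoc)
      ultimately show ?thesis
        by (auto simp: abs_if split: if_splits)
    qed
    moreover have False if anti: "d w' = - d w"
    proof -
      define L where "L = s + s'"
      have L: "L > 0" and w': "w' = w + of_real L * d w"
        using s s' eq anti by (auto simp: L_def algebra_simps)
      define U where "U = {p. Re (cnj (d w) * fst p) > 0 \<and> Re (cnj (d w) * snd p) < 0}"
      have "open U"
        unfolding U_def by (intro open_Collect_conj open_Collect_less continuous_intros)
      moreover have unit: "cnj (d w) * d w = 1"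
        using complex_norm_square[of "d w"] by (simp add: norm_d mult.commute)
      have "(d w, d w') \<in> U"
        by (simp only: U_def anti mem_Collect_eq fst_conv snd_conv mult_minus_right unit) simp
      ultimately obtain n where "(e n w, e n w') \<in> U"
        using clust w by blast
      then show False
        using ray_field_no_facing_rays[OF e[of n] L norm_d[of w], of w] ray[OF w(1)] sub[of n]
        by (auto simp: U_def w')
    qed
    ultimately show ?thesis
      by auto
  qed
  then show ?thesis
    unfolding is_half_line_field_def closed_ray_def using norm_d ray by (intro exI[of _ d]) blast
qed

section \<open>From overlapping to disjoint half-lines\<close>

lemma open_rays_same_direction:
  assumes "open_ray a \<delta> \<inter> open_ray b \<delta> \<noteq> {}"
  obtains c where "b = a + of_real c * \<delta>"
proof -
  obtain s t where "a + of_real s * \<delta> = b + of_real t * \<delta>"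
    using assms by (auto simp: open_ray_def)
  then have "b = a + of_real (s - t) * \<delta>"
    by (simp add: algebra_simps)
  then show thesis
    by (rule that)
qed

text \<open>
  Half-lines of the field that overlap lie on one line and have the same direction. The union of the
  half-lines that overlap with that of \<open>w\<close> is \<open>H w\<close>. Either \<open>H w\<close> is an open half-line, whose
  origin belongs to \<open>A\<close> because \<open>A\<close> is closed, or it is a full line, which is cut into two opposite
  half-lines at the foot of the perpendicular from 0, a point that depends only on the line. Different sets
  \<open>H w\<close> are disjoint, so the resulting open half-lines are disjoint.
\<close>
lemma half_lines_of_field:
  assumes A: "closed A" and d: "is_half_line_field A d"
  shows "\<exists>R. (\<forall>(a, e)\<in>R. norm e = 1) \<and> A = (\<Union>(a, e)\<in>R. closed_ray a e) \<and>
             disjoint_family_on (\<lambda>(a, e). open_ray a e) R"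
proof -
  \<comment> \<open>\<open>T w\<close> holds the positions, on the line through \<open>w\<close>, of the points whose half-lines overlap with that of \<open>w\<close>.\<close>
  define T where "T = (\<lambda>w. {t. w + of_real t * d w \<in> A \<and> d (w + of_real t * d w) = d w})"
  define origin where "origin = (\<lambda>w. w + of_real (Inf (T w)) * d w)"
  define foot where "foot = (\<lambda>w. w - of_real (inner w (d w)) * d w)"
  define S where "S = (\<lambda>w. if bdd_below (T w) then {(origin w, d w)} else {(foot w, d w), (foot w, - d w)})"
  define H where "H = (\<lambda>w. \<Union>t\<in>T w. open_ray (w + of_real t * d w) (d w))"
  have foot_line: "foot w + of_real s * d w = w + of_real (s - inner w (d w)) * d w" for w s
    by (simp add: foot_def algebra_simps)
  have norm_d: "norm (d w) = 1" if "w \<in> A" for w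
    using d that by (simp add: is_half_line_field_def)
  have inner_d: "inner (d w) (d w) = 1" if "w \<in> A" for w
    using norm_d[OF that] by (simp add: norm_eq_1)
  have zero: "0 \<in> T w" if "w \<in> A" for w
    using that by (simp add: T_def)
  have in_H: "w + of_real s * d w \<in> H w" if "t \<in> T w" "t < s" for w s t
  proof -
    have "w + of_real s * d w = (w + of_real t * d w) + of_real (s - t) * d w"
      by (simp add: algebra_simps)
    then show ?thesis
      unfolding H_def open_ray_def using that by (intro UN_I[of t]) (auto intro!: exI[of _ "s - t"])
  qed
  have H_sub: "H w \<subseteq> A" for w
  proof -
    have "closed_ray (w + of_real t * d w) (d w) \<subseteq> A" if "t \<in> T w" for t
      using that d unfolding is_half_line_field_def T_def by (metis (mono_tags, lifting) mem_Collect_eq)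
    moreover have "open_ray a e \<subseteq> closed_ray a e" for a e
      by (force simp: open_ray_def closed_ray_def)
    ultimately show ?thesis
      unfolding H_def by blast
  qed

  have closed_S: "closed_ray a e \<subseteq> A" if "w \<in> A" "(a, e) \<in> S w" for w a e
  proof (cases "bdd_below (T w)")
    case True
    then have ae: "a = origin w" "e = d w"
      using that by (auto simp: S_def)
    have above: "w + of_real s * d w \<in> A" if s: "s > Inf (T w)" for s
    proof -
      obtain t where "t \<in> T w" "t < s"
        using cInf_lessD[OF _ s] zero[OF \<open>w \<in> A\<close>] by auto
      then show ?thesis
        using in_H H_sub by blast
    qed
    have "w + of_real s * d w \<in> A" if "s \<ge> Inf (T w)" for s
    proof (cases "s = Inf (T w)")
      case True
      have "closed ((\<lambda>t. w + of_real t * d w) -` A)"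
        by (intro closed_vimage A continuous_intros)
      moreover have "{Inf (T w)<..} \<subseteq> (\<lambda>t. w + of_real t * d w) -` A"
        using above by auto
      ultimately have "closure {Inf (T w)<..} \<subseteq> (\<lambda>t. w + of_real t * d w) -` A"
        by (rule closure_minimal[rotated])
      then show ?thesis
        using that by auto
    qed (use above that in auto)
    from this[of "Inf (T w) + s" for s] have "w + of_real (Inf (T w) + s) * d w \<in> A" if "s \<ge> 0" for s
      using that by simp
    then show ?thesis
      by (auto simp: ae closed_ray_def origin_def algebra_simps)
  next
    case False
    have "w + of_real s * d w \<in> A" for s
    proof -
      obtain t where "t \<in> T w" "t < s"
        using False unfolding bdd_below_def by (meson not_le)
      then show ?thesis
        using in_H H_sub by blast
    qed
    then have line: "foot w + of_real s * d w \<in> A" for s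
      by (simp only: foot_line)
    show ?thesis
      using line line[of "- s" for s] that False by (auto simp: S_def closed_ray_def)
  qed
  have cover: "\<exists>(a, e)\<in>S w. w \<in> closed_ray a e" if "w \<in> A" for w
  proof (cases "bdd_below (T w)")
    case True
    then have "Inf (T w) \<le> 0"
      using zero[OF that] by (rule cInf_lower[rotated])
    then have "w \<in> closed_ray (origin w) (d w)"
      unfolding closed_ray_def origin_def by (auto intro!: exI[of _ "- Inf (T w)"])
    then show ?thesis
      using True by (simp add: S_def)
  next
    case False
    show ?thesis
    proof (cases "inner w (d w) \<ge> 0")
      case True
      then have "w \<in> closed_ray (foot w) (d w)"
        unfolding closed_ray_def foot_def by (auto intro!: exI[of _ "inner w (d w)"])
      then show ?thesis
        using False by (simp add: S_def)
    next
      case neg: False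
      then have "w \<in> closed_ray (foot w) (- d w)"
        unfolding closed_ray_def foot_def by (auto intro!: exI[of _ "- inner w (d w)"])
      then show ?thesis
        using False by (simp add: S_def)
    qed
  qed
  have open_S: "open_ray a e \<subseteq> H w" if "w \<in> A" "(a, e) \<in> S w" for w a e
  proof (cases "bdd_below (T w)")
    case True
    then have ae: "a = origin w" "e = d w"
      using that by (auto simp: S_def)
    have "origin w + of_real s * d w \<in> H w" if s: "s > 0" for s
    proof -
      obtain t where "t \<in> T w" "t < Inf (T w) + s"
        using cInf_lessD[of "T w" "Inf (T w) + s"] s zero[OF \<open>w \<in> A\<close>] by auto
      from in_H[OF this] show ?thesis
        by (simp add: origin_def algebra_simps)
    qed
    then show ?thesis
      by (auto simp: ae open_ray_def)
  next
    case False
    have "w + of_real s * d w \<in> H w" for s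
    proof -
      obtain t where "t \<in> T w" "t < s"
        using False unfolding bdd_below_def by (meson not_le)
      then show ?thesis
        using in_H by blast
    qed
    then have line: "foot w + of_real s * d w \<in> H w" for s
      by (simp only: foot_line)
    show ?thesis
      using line line[of "- s" for s] that False by (auto simp: S_def open_ray_def)
  qed
  \<comment> \<open>\<open>S w\<close> depends only on the class of \<open>w\<close>: moving \<open>w\<close> along its line only translates \<open>T w\<close>.\<close>
  have S_eq: "S w = S w'" if w: "w \<in> A" "w' \<in> A" and meet: "H w \<inter> H w' \<noteq> {}" for w w'
  proof -
    obtain t t' where t: "t \<in> T w" "t' \<in> T w'"
      and tt: "open_ray (w + of_real t * d w) (d w) \<inter> open_ray (w' + of_real t' * d w') (d w') \<noteq> {}"
      using meet by (fastforce simp: H_def)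
    define v v' where "v = w + of_real t * d w" and "v' = w' + of_real t' * d w'"
    have v: "v \<in> A" "v' \<in> A" "d v = d w" "d v' = d w'"
      using t by (auto simp: T_def v_def v'_def)
    have dd: "d w = d w'"
      using d v tt unfolding is_half_line_field_def v_def[symmetric] v'_def[symmetric] by metis
    obtain c0 where "v' = v + of_real c0 * d w"
      using open_rays_same_direction[of v "d w" v'] tt dd by (auto simp: v_def v'_def)
    then have "w' = w + of_real (t + c0 - t') * d w"
      by (simp add: v_def v'_def dd algebra_simps)
    then obtain c where c: "w' = w + of_real c * d w"
      by blast
    have dd': "d w' = d w"
      using dd by simp
    have shift: "w' + of_real x * d w = w + of_real (c + x) * d w" for x
      unfolding c by (simp add: algebra_simps)
    have T: "T w = (\<lambda>x. c + x) ` T w'"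
    proof (intro equalityI subsetI)
      fix x assume "x \<in> T w"
      then have "x - c \<in> T w'"
        by (simp only: T_def dd' shift) simp
      then show "x \<in> (\<lambda>x. c + x) ` T w'"
        by (intro image_eqI[of _ _ "x - c"]) auto
    qed (auto simp only: T_def dd' shift mem_Collect_eq)
    have bdd: "bdd_below (T w) \<longleftrightarrow> bdd_below (T w')"
    proof -
      have "bdd_below ((\<lambda>x. c + x) ` X) \<longleftrightarrow> bdd_below X" for X :: "real set"
      proof
        assume "bdd_below ((\<lambda>x. c + x) ` X)"
        then obtain m where "\<And>x. x \<in> X \<Longrightarrow> m \<le> c + x" by (auto simp: bdd_below_def)
        then show "bdd_below X"
          by (intro bdd_belowI[of _ "m - c"]) (simp add: algebra_simps)
      next
        assume "bdd_below X"
        then obtain m where "\<And>x. x \<in> X \<Longrightarrow> m \<le> x" by (auto simp: bdd_below_def)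
        then show "bdd_below ((\<lambda>x. c + x) ` X)"
          by (intro bdd_belowI[of _ "m + c"]) (auto simp: algebra_simps)
      qed
      then show ?thesis
        by (simp add: T)
    qed
    have "origin w = origin w'" if b: "bdd_below (T w')"
    proof -
      have "Inf (T w) = c + Inf (T w')"
      proof (rule cInf_eq_non_empty)
        show "T w \<noteq> {}" using zero[OF w(1)] by blast
        show "c + Inf (T w') \<le> x" if "x \<in> T w" for x
          using that b by (auto simp: T intro: cInf_lower)
        show "y \<le> c + Inf (T w')" if y: "\<And>x. x \<in> T w \<Longrightarrow> y \<le> x" for y
        proof -
          have "y - c \<le> Inf (T w')"
            using y zero[OF w(2)] by (intro cInf_greatest) (auto simp: T algebra_simps)
          then show ?thesis by simp
        qed
      qed
      then show ?thesis
        by (simp only: origin_def dd' shift)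
    qed
    moreover have "foot w = foot w'"
    proof -
      have "inner w' (d w') = inner w (d w) + c"
        unfolding dd' using inner_d[OF w(1)] by (simp add: c inner_add_left flip: scaleR_conv_of_real)
      then show ?thesis
        unfolding foot_def dd' unfolding c by (simp add: algebra_simps)
    qed
    ultimately show ?thesis
      unfolding S_def bdd by (simp add: dd)
  qed
  have disj: "open_ray a e \<inter> open_ray a' e' = {}"
    if "w \<in> A" "(a, e) \<in> S w" "(a', e') \<in> S w" "(a, e) \<noteq> (a', e')" for w a e a' e'
  proof -
    have "open_ray p (d w) \<inter> open_ray p (- d w) = {}" for p
    proof -
      have "d w \<noteq> 0"
        using norm_d[OF that(1)] by auto
      then have "of_real s * d w \<noteq> - (of_real t * d w)" if "s > 0" "t > 0" for s t
        using that by (metis add_pos_pos eq_neg_iff_add_eq_0 less_irrefl mult_eq_0_iff of_real_add of_real_eq_0_iff ring_distribs(2))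
      then show ?thesis
        by (fastforce simp: open_ray_def)
    qed
    then have "x \<notin> open_ray p (- d w)" if "x \<in> open_ray p (d w)" for x p
      using that by blast
    then show ?thesis
      using that by (auto simp: S_def split: if_splits)
  qed
  define R where "R = (\<Union>w\<in>A. S w)"
  have "\<forall>(a, e)\<in>R. norm e = 1"
    using norm_d by (auto simp: R_def S_def split: if_splits)
  moreover have "A = (\<Union>(a, e)\<in>R. closed_ray a e)"
    using cover closed_S unfolding R_def by fast
  moreover have "disjoint_family_on (\<lambda>(a, e). open_ray a e) R"
  proof -
    have "open_ray a e \<inter> open_ray a' e' = {}"
      if ne: "(a, e) \<noteq> (a', e')" and w: "w \<in> A" "(a, e) \<in> S w" and w': "w' \<in> A" "(a', e') \<in> S w'"
      for a e a' e' w w'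
    proof (cases "S w = S w'")
      case True
      then show ?thesis
        using disj[of w a e a' e'] ne w w' by auto
    next
      case False
      then have "H w \<inter> H w' = {}"
        using S_eq w(1) w'(1) by blast
      then show ?thesis
        using open_S[OF w] open_S[OF w'] by blast
    qed
    then show ?thesis
      unfolding R_def disjoint_family_on_def by fast
  qed
  ultimately show ?thesis
    by blast
qed

section \<open>Alexander's theorem\<close>

text \<open>
  If a point \<open>p\<close> of the convex hull were missing from \<open>K\<close>, the segment to \<open>p\<close> from an interior point
  \<open>q\<close> would leave \<open>K\<close> at a frontier point \<open>b\<close>. A half-space that supports \<open>K\<close> at \<open>b\<close> contains
  \<open>q\<close> in its interior and contains the hull, which is impossible for \<open>b\<close> strictly between \<open>q\<close> and \<open>p\<close>.
\<close>
lemma convex_if_supported_at_frontier: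
  fixes K :: "'a::euclidean_space set"
  assumes "closed K" "interior K \<noteq> {}"
    and supp: "\<And>b. b \<in> frontier K \<Longrightarrow> \<exists>a. a \<noteq> 0 \<and> (\<forall>y\<in>K. inner a y \<le> inner a b)"
  shows "convex K"
proof -
  have "convex hull K \<subseteq> K"
  proof
    fix p assume p: "p \<in> convex hull K"
    show "p \<in> K"
    proof (rule ccontr)
      assume "p \<notin> K"
      obtain q where q: "q \<in> interior K"
        using assms by blast
      have "closed_segment q p \<inter> frontier K \<noteq> {}"
        using q \<open>p \<notin> K\<close> interior_subset by (intro connected_Int_frontier) auto
      then obtain b where b: "b \<in> closed_segment q p" "b \<in> frontier K"
        by blast
      then obtain a where a: "a \<noteq> 0" "\<forall>y\<in>K. inner a y \<le> inner a b"
        using supp by blast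
      obtain u where u: "0 \<le> u" "u \<le> 1" "b = (1 - u) *\<^sub>R q + u *\<^sub>R p"
        using b by (auto simp: in_segment)
      have "convex hull K \<subseteq> {y. inner a y \<le> inner a b}"
        using a by (intro hull_minimal convex_halfspace_le) auto
      then have ap: "inner a p \<le> inner a b"
        using p by blast
      obtain d where d: "d > 0" "cball q d \<subseteq> K"
        using q by (meson mem_interior_cball)
      have "q + (d / norm a) *\<^sub>R a \<in> K"
        using d a by (intro subsetD[OF d(2)]) (auto simp: dist_norm)
      then have "inner a q + (d / norm a) * inner a a \<le> inner a b"
        using a by (auto simp: inner_add_right)
      moreover have "(d / norm a) * inner a a > 0"
        using a d by (intro mult_pos_pos) auto
      ultimately have aq: "inner a q < inner a b"
        by linarith
      have "b \<in> frontier K" "q \<in> interior K" using b q by auto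
      then have "b \<noteq> q"
        by (auto simp: frontier_def)
      moreover have "p \<noteq> b"
        using b \<open>p \<notin> K\<close> \<open>closed K\<close> frontier_subset_closed by blast
      ultimately have "0 < u" "u < 1"
        using u by (cases "u = 0"; cases "u = 1"; auto)+
      have "inner a b = (1 - u) * inner a q + u * inner a p"
        by (subst u(3)) (simp add: inner_add_right)
      also have "\<dots> < (1 - u) * inner a b + u * inner a b"
        using aq ap \<open>0 < u\<close> \<open>u < 1\<close> by (intro add_less_le_mono) auto
      finally show False
        by (simp add: algebra_simps)
    qed
  qed
  then show ?thesis
    by (metis convex_convex_hull hull_subset subset_antisym)
qed

lemma has_vector_derivative_cis: "(cis has_vector_derivative \<i> * cis t) (at t)"
proof -
  have "((\<lambda>t. exp (of_real t * \<i>)) has_vector_derivative \<i> * exp (of_real t * \<i>)) (at t)"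
    by (rule exp_scaleR_has_vector_derivative_left[unfolded scaleR_conv_of_real])
  then show ?thesis
    by (simp add: cis_conv_exp[abs_def] mult.commute)
qed

lemma has_real_derivative_Re_along:
  assumes "(H has_field_derivative H') (at (\<gamma> t))" "(\<gamma> has_vector_derivative v) (at t)"
  shows "((\<lambda>t. Re (H (\<gamma> t))) has_real_derivative Re (v * H')) (at t)"
proof -
  have "((H \<circ> \<gamma>) has_vector_derivative v * H') (at t)"
    using assms by (intro field_vector_diff_chain_at)
  from bounded_linear.has_vector_derivative[OF bounded_linear_Re this] show ?thesis
    by (simp add: has_real_derivative_iff_has_vector_derivative o_def)
qed

text \<open>
  The condition says that \<open>z exp (M z)\<close>, whose logarithmic derivative is \<open>(1 + z M'(z)) / z\<close>, is a
  starlike function. Working with the exponent \<open>M\<close> makes the argument of this function on a circle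
  available as the smooth function \<open>t + Im (M (r e\<^sup>i\<^sup>t))\<close>.
\<close>
locale starlike_exponent =
  fixes M :: "complex \<Rightarrow> complex"
  assumes hol: "M holomorphic_on unit_disc"
    and Re_pos: "\<And>z. z \<in> unit_disc \<Longrightarrow> Re (1 + z * deriv M z) > 0"
begin

text \<open>
  Starlikeness makes the argument of \<open>G z = z exp (M z)\<close> strictly increasing along the circle through
  \<open>z0\<close>, and one turn increases it by exactly \<open>2 \<pi>\<close>, so no direction is attained twice. The hypothesis on
  \<open>z1\<close> says that \<open>G z1\<close> and \<open>G z0\<close> have the same direction.
\<close>
lemma inj_direction_on_circle:
  assumes z0: "0 < norm z0" "norm z0 < 1" and z1: "norm z1 = norm z0"
    and dir: "Im (cnj (z0 * exp (M z0)) * (z1 * exp (M z1))) = 0"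
      "Re (cnj (z0 * exp (M z0)) * (z1 * exp (M z1))) > 0"
  shows "z1 = z0"
proof -
  define \<theta> where "\<theta> = Arg2pi (z1 / z0)"
  have \<theta>: "0 \<le> \<theta>" "\<theta> < 2 * pi"
    unfolding \<theta>_def by (auto simp: Arg2pi_ge_0 Arg2pi_lt_2pi)
  have z1_eq: "z1 = z0 * cis \<theta>"
  proof -
    have "z1 / z0 = cis \<theta>"
      using Arg2pi_eq[of "z1 / z0"] z0 z1 by (simp add: \<theta>_def norm_divide cis_conv_exp)
    then show ?thesis
      using z0 by (auto simp: field_simps)
  qed
  define A where "A = (\<lambda>t. t + Im (M (z0 * cis t)) - Im (M z0))"
  have deriv: "\<exists>y. (A has_real_derivative y) (at t) \<and> y > 0" for t
  proof -
    have in_disc: "z0 * cis t \<in> unit_disc"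
      using z0 by (simp add: norm_mult)
    have "((\<lambda>z. - \<i> * M z) has_field_derivative - \<i> * deriv M (z0 * cis t)) (at (z0 * cis t))"
      using holomorphic_derivI[OF hol open_ball in_disc] by (rule DERIV_cmult)
    moreover have "((\<lambda>t. z0 * cis t) has_vector_derivative z0 * (\<i> * cis t)) (at t)"
      by (intro has_vector_derivative_mult_right has_vector_derivative_cis)
    ultimately have "((\<lambda>t. Re (- \<i> * M (z0 * cis t))) has_real_derivative
        Re (z0 * (\<i> * cis t) * (- \<i> * deriv M (z0 * cis t)))) (at t)"
      by (rule has_real_derivative_Re_along)
    moreover have "Re (z0 * (\<i> * cis t) * (- \<i> * deriv M (z0 * cis t))) = Re (z0 * cis t * deriv M (z0 * cis t))"
      by (simp add: algebra_simps)
    moreover have "(\<lambda>t. Re (- \<i> * M (z0 * cis t))) = (\<lambda>t. Im (M (z0 * cis t)))"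
      by simp
    ultimately have "((\<lambda>t. Im (M (z0 * cis t))) has_real_derivative Re (z0 * cis t * deriv M (z0 * cis t))) (at t)"
      by metis
    then have "(A has_real_derivative 1 + Re (z0 * cis t * deriv M (z0 * cis t))) (at t)"
      using DERIV_diff[OF DERIV_add[OF DERIV_ident] DERIV_const[of "Im (M z0)"]] unfolding A_def by fastforce
    then show ?thesis
      using Re_pos[OF in_disc] by auto
  qed
  have A0: "A 0 = 0" and A2pi: "A (2 * pi) = 2 * pi"
    by (simp_all add: A_def)
  have eq: "cnj (z0 * exp (M z0)) * (z1 * exp (M z1)) =
      of_real ((norm z0)\<^sup>2 * exp (Re (M z0) + Re (M z1))) * cis (A \<theta>)"
  proof -
    have "cnj (z0 * exp (M z0)) * (z1 * exp (M z1)) = (z0 * cnj z0) * (cis \<theta> * cnj (exp (M z0)) * exp (M z1))"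
      by (simp add: z1_eq)
    also have "cis \<theta> * cnj (exp (M z0)) * exp (M z1) = exp (\<i> * \<theta> + cnj (M z0) + M z1)"
      by (simp add: cis_conv_exp exp_add exp_cnj)
    also have "\<dots> = of_real (exp (Re (M z0) + Re (M z1))) * cis (A \<theta>)"
      by (subst exp_eq_polar) (simp add: A_def z1_eq exp_of_real algebra_simps)
    also have "z0 * cnj z0 = of_real ((norm z0)\<^sup>2)"
      using complex_norm_square[of z0] by simp
    finally show ?thesis
      by simp
  qed
  define c where "c = (norm z0)\<^sup>2 * exp (Re (M z0) + Re (M z1))"
  have "c > 0"
    using z0 by (simp add: c_def)
  moreover have "c * sin (A \<theta>) = 0" "c * cos (A \<theta>) > 0"
    using dir unfolding eq c_def[symmetric] by simp_all
  ultimately have "sin (A \<theta>) = 0" "cos (A \<theta>) > 0"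
    by (auto simp: zero_less_mult_iff)
  then have "cos (A \<theta>) = 1"
    using sin_cos_squared_add[of "A \<theta>"] by (simp add: power2_eq_1_iff)
  then obtain n :: int where n: "A \<theta> = of_int n * 2 * pi"
    by (auto simp: cos_one_2pi_int)
  have "A \<theta> < 2 * pi"
    using DERIV_pos_imp_increasing[OF \<theta>(2), of A] deriv A2pi by auto
  have "\<theta> = 0"
  proof (rule ccontr)
    assume "\<theta> \<noteq> 0"
    then have "0 < A \<theta>"
      using DERIV_pos_imp_increasing[of 0 \<theta> A] \<theta> deriv A0 by auto
    then have "0 < n" "n < 1"
      using n \<open>A \<theta> < 2 * pi\<close> by (auto simp: zero_less_mult_iff)
    then show False by simp
  qed
  then show ?thesis
    by (simp add: z1_eq)
qed

end

text \<open>
  By Alexander's theorem, a primitive \<open>g\<close> of \<open>G z / z = exp (M z)\<close> is univalent and maps discs around 0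
  onto convex sets. Both facts follow from the support property below.
\<close>
locale convex_primitive = starlike_exponent +
  fixes g :: "complex \<Rightarrow> complex"
  assumes g: "\<And>z. z \<in> unit_disc \<Longrightarrow> (g has_field_derivative exp (M z)) (at z)"
begin

lemma g_holomorphic: "g holomorphic_on unit_disc"
  unfolding holomorphic_on_open[OF open_ball] using g by blast

text \<open>
  Where \<open>Re (a g z)\<close> attains its maximum over a closed disc, necessarily on the circle, the
  radial derivative of \<open>a g\<close>, a positive multiple of \<open>a z g'(z) = a G z\<close>, is real and nonnegative. For \<open>a = cnj (G z0)\<close> this forces \<open>G z\<close> to
  have the direction of \<open>G z0\<close>, and so the maximum is attained only at \<open>z0\<close>.
\<close>
lemma support_at_circle:
  assumes z0: "0 < norm z0" "norm z0 < 1" and z: "norm z \<le> norm z0" "z \<noteq> z0"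
  shows "Re (cnj (z0 * exp (M z0)) * g z) < Re (cnj (z0 * exp (M z0)) * g z0)"
proof -
  define r where "r = norm z0"
  define a where "a = cnj (z0 * exp (M z0))"
  define H where "H = (\<lambda>z. a * g z)"
  have r: "0 < r" "r < 1" using z0 by (auto simp: r_def)
  have a: "a \<noteq> 0" using z0 by (auto simp: a_def)
  have in_disc: "w \<in> unit_disc" if "w \<in> cball 0 r" for w
    using that r by auto
  have H': "(H has_field_derivative a * exp (M w)) (at w)" if "w \<in> cball 0 r" for w
    unfolding H_def using g[OF in_disc[OF that]] by (rule DERIV_cmult)
  have max_eq: "m = z0" if m: "m \<in> cball 0 r" and max: "\<And>w. w \<in> cball 0 r \<Longrightarrow> Re (H w) \<le> Re (H m)" for m
  proof -
    define h where "h = a * exp (M m)"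
    have h: "h \<noteq> 0" "(H has_field_derivative h) (at m)"
      using a H'[OF m] by (auto simp: h_def)
    \<comment> \<open>An interior maximum would be beaten by a step in the direction of steepest ascent, \<open>cnj h\<close>.\<close>
    have "norm m = r"
    proof (rule ccontr)
      assume "norm m \<noteq> r"
      then have mr: "norm m < r" using m by auto
      have "((\<lambda>t. m + of_real t * cnj h) has_vector_derivative cnj h) (at 0)"
        by (auto intro!: derivative_eq_intros)
      then have "((\<lambda>t. Re (H (m + of_real t * cnj h))) has_real_derivative Re (cnj h * h)) (at 0)"
        using h by (intro has_real_derivative_Re_along) auto
      moreover have "0 < (r - norm m) / norm h"
        using mr h by auto
      moreover have "Re (H (m + of_real t * cnj h)) \<le> Re (H m)" if "\<bar>0 - t\<bar> < (r - norm m) / norm h" for t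
      proof (rule max)
        have "norm (m + of_real t * cnj h) \<le> norm m + \<bar>t\<bar> * norm h"
          using norm_triangle_ineq[of m "of_real t * cnj h"] by (simp add: norm_mult)
        also have "\<dots> \<le> r"
          using that h by (simp add: field_simps)
        finally show "m + of_real t * cnj h \<in> cball 0 r"
          by simp
      qed
      ultimately have "Re (cnj h * h) = 0"
        by (intro DERIV_local_max[where x = 0]) auto
      moreover have "cnj h * h = of_real ((norm h)\<^sup>2)"
        using complex_norm_square[of h] by (simp add: mult.commute)
      ultimately show False
        using h by simp
    qed
    \<comment> \<open>The tangential derivative vanishes, and the radial one cannot be negative.\<close>
    have "Re (m * \<i> * h) = 0"
    proof (rule DERIV_local_max)
      have "((\<lambda>t. m * cis t) has_vector_derivative m * \<i>) (at 0)"
        using has_vector_derivative_mult_right[OF has_vector_derivative_cis[of 0], of m] by simp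
      then show "((\<lambda>t. Re (H (m * cis t))) has_real_derivative Re (m * \<i> * h)) (at 0)"
        using h by (intro has_real_derivative_Re_along) auto
      show "\<forall>t. \<bar>0 - t\<bar> < 1 \<longrightarrow> Re (H (m * cis t)) \<le> Re (H (m * cis 0))"
        using max m by (simp add: norm_mult)
    qed simp
    then have Im0: "Im (m * h) = 0"
      by (simp add: algebra_simps)
    have "Re (m * h) \<ge> 0"
    proof (rule ccontr)
      assume neg: "\<not> ?thesis"
      have "((\<lambda>t. of_real t * m) has_vector_derivative m) (at 1)"
        by (auto intro!: derivative_eq_intros)
      then have "((\<lambda>t. Re (H (of_real t * m))) has_real_derivative Re (m * h)) (at 1)"
        using h by (intro has_real_derivative_Re_along) auto
      then obtain d where d: "d > 0" "\<And>s. s > 0 \<Longrightarrow> s < d \<Longrightarrow> Re (H (of_real 1 * m)) < Re (H (of_real (1 - s) * m))"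
        using DERIV_neg_dec_left neg by (metis not_le)
      define s where "s = min (d / 2) (1 / 2)"
      have s: "s > 0" "s < d" "s < 1"
        using d by (auto simp: s_def)
      have "of_real (1 - s) * m \<in> cball 0 r"
      proof -
        have "norm (of_real (1 - s) * m) = (1 - s) * norm m"
          using s unfolding norm_mult norm_of_real by simp
        also have "\<dots> \<le> 1 * norm m"
          using s by (intro mult_right_mono) auto
        finally show ?thesis
          using m by simp
      qed
      from max[OF this] d(2)[OF s(1,2)] show False
        by simp
    qed
    moreover have "m * h \<noteq> 0"
      using h \<open>norm m = r\<close> r by auto
    ultimately have "Re (m * h) > 0"
      using Im0 by (auto simp: complex_eq_iff less_le)
    moreover have "m * h = cnj (z0 * exp (M z0)) * (m * exp (M m))"
      by (simp add: h_def a_def)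
    moreover have "norm m = norm z0"
      using \<open>norm m = r\<close> by (simp add: r_def)
    ultimately show "m = z0"
      using inj_direction_on_circle[OF z0, of m] Im0 by metis
  qed
  have "continuous_on (cball 0 r) (\<lambda>w. Re (H w))"
    by (intro continuous_intros continuous_at_imp_continuous_on ballI)
      (use H' DERIV_isCont in blast)
  then obtain m where m: "m \<in> cball 0 r" "\<And>w. w \<in> cball 0 r \<Longrightarrow> Re (H w) \<le> Re (H m)"
    using continuous_attains_sup[of "cball 0 r" "\<lambda>w. Re (H w)"] r by (auto simp: cball_eq_empty)
  have "m = z0"
    by (rule max_eq[OF m])
  have "Re (H z) < Re (H z0)"
  proof (rule ccontr)
    assume "\<not> ?thesis"
    then have "Re (H w) \<le> Re (H z)" if "w \<in> cball 0 r" for w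
      using m(2)[OF that] \<open>m = z0\<close> by simp
    then have "z = z0"
      using z by (intro max_eq) (auto simp: r_def)
    with z show False by simp
  qed
  then show ?thesis
    by (simp add: H_def a_def)
qed

lemma g_inj: "inj_on g unit_disc"
proof -
  have "g z \<noteq> g w" if "norm w < 1" "norm z \<le> norm w" "z \<noteq> w" for z w
  proof -
    have "0 < norm w"
      using that by (cases "w = 0") auto
    from support_at_circle[OF this that] show ?thesis
      by auto
  qed
  then show ?thesis
    unfolding inj_on_def by (metis dist_0_norm linear mem_ball)
qed

lemma compact_g_cball: "r < 1 \<Longrightarrow> compact (g ` cball 0 r)"
  by (intro compact_continuous_image holomorphic_on_imp_continuous_on holomorphic_on_subset[OF g_holomorphic])
    auto

text \<open>
  By the open mapping property, a frontier point of the image is \<open>g z\<close> with \<open>z\<close> on the circle, and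
  there \<open>G z\<close> is an outward normal.
\<close>
lemma convex_g_cball:
  assumes r: "0 < r" "r < 1"
  shows "convex (g ` cball 0 r)"
proof (rule convex_if_supported_at_frontier)
  show closed: "closed (g ` cball 0 r)"
    using compact_g_cball r compact_imp_closed by blast
  have "continuous_on (ball 0 r) g" "inj_on g (ball 0 r)"
    using holomorphic_on_imp_continuous_on[OF g_holomorphic] g_inj r
    by (auto intro: continuous_on_subset inj_on_subset)
  then have "open (g ` ball 0 r)"
    by (intro invariance_of_domain) auto
  then have int: "g ` ball 0 r \<subseteq> interior (g ` cball 0 r)"
    by (intro interior_maximal image_mono) auto
  then show "interior (g ` cball 0 r) \<noteq> {}"
    using r by fastforce
  show "\<exists>a. a \<noteq> 0 \<and> (\<forall>y\<in>g ` cball 0 r. inner a y \<le> inner a b)" if b: "b \<in> frontier (g ` cball 0 r)" for b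
  proof -
    have "b \<in> g ` cball 0 r" "b \<notin> g ` ball 0 r"
      using b closed int by (auto simp: frontier_def)
    then obtain z where z: "norm z = r" "b = g z"
      by force
    have inner_eq: "inner a y = Re (cnj a * y)" for a y
      by (simp add: inner_complex_def)
    have "inner (z * exp (M z)) (g y) \<le> inner (z * exp (M z)) (g z)" if "y \<in> cball 0 r" for y
      using support_at_circle[of z y] that z r unfolding inner_eq by (cases "y = z") auto
    then show ?thesis
      using z r by (intro exI[of _ "z * exp (M z)"]) auto
  qed
qed

text \<open>
  Let \<open>k\<close> be the inverse of \<open>g\<close>, so that \<open>u \<circ> k\<close> and \<open>v \<circ> k\<close> have the derivatives \<open>p = u' / g'\<close> and
  \<open>q = v' / g'\<close>. Along a segment with direction \<open>c\<close>, the inner product of the transplanted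
  function with \<open>c\<close> has the derivative \<open>\<bar>c\<bar>\<^sup>2 Re p + Re (c\<^sup>2 q)\<close>, which is positive because
  \<open>Re p > \<bar>q\<bar>\<close>. Convexity of \<open>K\<close> keeps the segment in the domain.
\<close>
lemma strictly_monotone_transplant:
  assumes u: "u holomorphic_on unit_disc" and v: "v holomorphic_on unit_disc"
    and dom: "\<And>z. z \<in> unit_disc \<Longrightarrow> Re (exp (- M z) * deriv u z) > cmod (exp (- M z) * deriv v z)"
    and k: "k holomorphic_on g ` unit_disc" "\<And>z. z \<in> unit_disc \<Longrightarrow> k (g z) = z"
    and K: "convex K" "K \<subseteq> g ` unit_disc"
  shows "strictly_monotone_on K (\<lambda>w. u (k w) + cnj (v (k w)))"
  unfolding strictly_monotone_on_def
proof (intro ballI impI)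
  fix b a assume ab: "b \<in> K" "a \<in> K" "b \<noteq> a"
  define F where "F = (\<lambda>w. u (k w) + cnj (v (k w)))"
  define c where "c = b - a"
  \<comment> \<open>The real part of the holomorphic function \<open>H\<close> is the inner product of \<open>F\<close> with \<open>c\<close>.\<close>
  define H where "H = (\<lambda>w. cnj c * u (k w) + c * v (k w))"
  have H_eq: "Re (H w) = inner (F w) c" for w
    by (simp add: H_def F_def inner_complex_def algebra_simps)
  have k': "(k has_field_derivative exp (- M z)) (at (g z))" if "z \<in> unit_disc" for z
  proof -
    have "open (g ` unit_disc)"
      by (rule open_mapping_thm3[OF g_holomorphic open_ball g_inj])
    then have "(k has_field_derivative deriv k (g z)) (at (g z))"
      using k that by (intro holomorphic_derivI) auto
    from DERIV_chain[OF this g[OF that]]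
    have "((k \<circ> g) has_field_derivative deriv k (g z) * exp (M z)) (at z)" .
    then have "((\<lambda>z. z) has_field_derivative deriv k (g z) * exp (M z)) (at z)"
      by (rule has_field_derivative_transform_within_open[OF _ open_ball that]) (use k in auto)
    then have "deriv k (g z) * exp (M z) = 1"
      using DERIV_ident DERIV_unique by blast
    then have "deriv k (g z) = exp (- M z)"
      by (simp add: exp_minus field_simps)
    then show ?thesis
      using \<open>(k has_field_derivative deriv k (g z)) (at (g z))\<close> by simp
  qed
  have "\<exists>y. ((\<lambda>t. Re (H (a + of_real t * c))) has_real_derivative y) (at t) \<and> y > 0"
    if t: "0 \<le> t" "t \<le> 1" for t
  proof -
    have "a + of_real t * c = (1 - t) *\<^sub>R a + t *\<^sub>R b"
      by (simp add: c_def scaleR_conv_of_real algebra_simps)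
    then have "a + of_real t * c \<in> K"
      using convexD[OF K(1) ab(2,1), of "1 - t" t] t by simp
    then obtain z where z: "z \<in> unit_disc" "a + of_real t * c = g z"
      using K by auto
    define p q where "p = exp (- M z) * deriv u z" and "q = exp (- M z) * deriv v z"
    have "((\<lambda>w. u (k w)) has_field_derivative p) (at (g z))" "((\<lambda>w. v (k w)) has_field_derivative q) (at (g z))"
      unfolding p_def q_def mult.commute[of "exp _"]
      by (rule DERIV_chain2[OF _ k'[OF z(1)]]; use z k holomorphic_derivI[OF u open_ball] holomorphic_derivI[OF v open_ball] in simp)+
    then have "(H has_field_derivative cnj c * p + c * q) (at (a + of_real t * c))"
      unfolding H_def z(2) by (intro DERIV_add DERIV_cmult)
    moreover have "((\<lambda>t. a + of_real t * c) has_vector_derivative c) (at t)"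
      by (auto intro!: derivative_eq_intros)
    ultimately have "((\<lambda>t. Re (H (a + of_real t * c))) has_real_derivative Re (c * (cnj c * p + c * q))) (at t)"
      by (rule has_real_derivative_Re_along)
    moreover have "Re (c * (cnj c * p + c * q)) > 0"
    proof -
      have "c * (cnj c * p + c * q) = of_real ((norm c)\<^sup>2) * p + c\<^sup>2 * q"
        using complex_norm_square[of c] by (simp add: algebra_simps power2_eq_square)
      then have "Re (c * (cnj c * p + c * q)) = (norm c)\<^sup>2 * Re p + Re (c\<^sup>2 * q)"
        by simp
      moreover have "\<bar>Re (c\<^sup>2 * q)\<bar> \<le> (norm c)\<^sup>2 * norm q"
        using abs_Re_le_cmod[of "c\<^sup>2 * q"] by (simp add: norm_mult norm_power)
      moreover have "(norm c)\<^sup>2 * norm q < (norm c)\<^sup>2 * Re p"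
        using dom[OF z(1)] ab by (intro mult_strict_left_mono) (auto simp: p_def q_def c_def)
      ultimately show ?thesis
        by linarith
    qed
    ultimately show ?thesis
      by blast
  qed
  then have "Re (H (a + of_real 0 * c)) < Re (H (a + of_real 1 * c))"
    by (intro DERIV_pos_imp_increasing[of 0 1 "\<lambda>t. Re (H (a + of_real t * c))"]) auto
  then have "inner (F a) c < inner (F b) c"
    by (simp add: H_eq c_def)
  then show "inner (u (k b) + cnj (v (k b)) - (u (k a) + cnj (v (k a)))) (b - a) > 0"
    by (simp add: F_def c_def inner_diff_left)
qed

end

section \<open>Images under dominated harmonic functions\<close>

context convex_primitive
begin

text \<open>
  The compact convex sets \<open>g ` cball 0 (\<rho> n)\<close> exhaust the range of \<open>g\<close>. On each of them
  \<open>F = f \<circ> g\<^sup>-\<^sup>1\<close> is strictly monotone, which yields a ray field outside \<open>f ` cball 0 (\<rho> n)\<close>; the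
  half-lines for \<open>f ` unit_disc\<close> are obtained in the limit. Strict monotonicity also makes \<open>f\<close>
  injective, whence its image is open.
\<close>
theorem close_to_convex_if_dominated:
  assumes u: "u holomorphic_on unit_disc" and v: "v holomorphic_on unit_disc"
    and f: "\<And>z. z \<in> unit_disc \<Longrightarrow> f z = u z + cnj (v z)"
    and dom: "\<And>z. z \<in> unit_disc \<Longrightarrow> Re (exp (- M z) * deriv u z) > cmod (exp (- M z) * deriv v z)"
  shows "close_to_convex f"
proof -
  obtain k where k: "k holomorphic_on g ` unit_disc" "\<And>z. z \<in> unit_disc \<Longrightarrow> k (g z) = z"
    using holomorphic_has_inverse[OF g_holomorphic open_ball g_inj] by metis
  define F where "F = (\<lambda>w. u (k w) + cnj (v (k w)))"
  have F_g: "F (g z) = f z" if "z \<in> unit_disc" for z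
    using that by (simp add: F_def k f)
  define \<rho> where "\<rho> = (\<lambda>n. 1 - 1 / (real n + 2))"
  have \<rho>: "0 < \<rho> n" "\<rho> n < 1" for n
    by (simp_all add: \<rho>_def field_simps)
  have \<rho>_mono: "\<rho> m \<le> \<rho> n" if "m \<le> n" for m n
    using that by (simp add: \<rho>_def field_simps)
  have \<rho>_ex: "\<exists>n. x < \<rho> n" if "x < 1" for x
  proof -
    have "0 < 1 - x"
      using that by simp
    then obtain n where "inverse (real (Suc n)) < 1 - x"
      using reals_Archimedean by blast
    moreover have "1 / (real n + 2) \<le> inverse (real (Suc n))"
      by (simp add: field_simps)
    ultimately have "x < \<rho> n"
      by (simp add: \<rho>_def)
    then show ?thesis ..
  qed
  define K where "K = (\<lambda>n. g ` cball 0 (\<rho> n))"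
  have cball_sub: "cball 0 (\<rho> n) \<subseteq> unit_disc" for n
    using \<rho>(2)[of n] by auto
  have K: "compact (K n)" "convex (K n)" "K n \<noteq> {}" "K n \<subseteq> g ` unit_disc" for n
    unfolding K_def using \<rho>[of n] cball_sub[of n]
    by (auto simp: compact_g_cball convex_g_cball simp flip: ball_eq_empty)
  have contF: "continuous_on (g ` unit_disc) F"
  proof -
    have "continuous_on (g ` unit_disc) k"
      by (rule holomorphic_on_imp_continuous_on[OF k(1)])
    moreover have "k ` g ` unit_disc \<subseteq> unit_disc"
      using k(2) by auto
    ultimately show ?thesis
      unfolding F_def
      by (intro continuous_intros continuous_on_compose2[OF holomorphic_on_imp_continuous_on[OF u]]
          continuous_on_compose2[OF holomorphic_on_imp_continuous_on[OF v]]) auto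
  qed
  have mono: "strictly_monotone_on (K n) F" for n
    unfolding F_def by (rule strictly_monotone_transplant[OF u v dom k K(2,4)])
  have F_K: "F ` K n = f ` cball 0 (\<rho> n)" for n
    unfolding K_def image_image using F_g cball_sub[of n] by (intro image_cong) auto
  have inj: "inj_on f unit_disc"
  proof (rule inj_onI, rule ccontr)
    fix z w assume zw: "z \<in> unit_disc" "w \<in> unit_disc" "f z = f w" "z \<noteq> w"
    then obtain n where "max (norm z) (norm w) < \<rho> n"
      using \<rho>_ex[of "max (norm z) (norm w)"] by auto
    then have "g z \<in> K n" "g w \<in> K n"
      by (auto simp: K_def)
    moreover have "g z \<noteq> g w"
      using g_inj zw by (auto simp: inj_on_def)
    ultimately have "inner (F (g z) - F (g w)) (g z - g w) > 0"
      using mono[of n] unfolding strictly_monotone_on_def by blast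
    then show False
      using zw F_g by simp
  qed
  have contf: "continuous_on unit_disc f"
  proof -
    have "continuous_on unit_disc (\<lambda>z. u z + cnj (v z))"
      using u v by (intro continuous_intros holomorphic_on_imp_continuous_on)
    then show ?thesis
      by (rule continuous_on_eq) (simp add: f)
  qed
  have open_f: "open (f ` ball 0 r)" if "r \<le> 1" for r
    using that by (intro invariance_of_domain continuous_on_subset[OF contf] inj_on_subset[OF inj]) auto
  obtain e where e: "\<And>n. is_ray_field (f ` cball 0 (\<rho> n)) (e n)"
  proof -
    have "\<exists>e. is_ray_field (f ` cball 0 (\<rho> n)) e" for n
      using ray_field_of_strictly_monotone[OF K(1-3) continuous_on_subset[OF contF K(4)] mono, of n]
      by (simp only: F_K)
    then show thesis
      using that by metis
  qed
  have "\<exists>\<delta>>0. \<exists>N. \<forall>n\<ge>N. ball x \<delta> \<subseteq> f ` cball 0 (\<rho> n)" if x: "x \<in> f ` unit_disc" for x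
  proof -
    obtain z where z: "norm z < 1" "x = f z"
      using x by auto
    obtain N where N: "norm z < \<rho> N"
      using \<rho>_ex z by blast
    have "open (f ` ball 0 (\<rho> N))"
      using \<rho>[of N] by (intro open_f) simp
    moreover have "x \<in> f ` ball 0 (\<rho> N)"
      using z N by auto
    ultimately obtain \<delta> where \<delta>: "\<delta> > 0" "ball x \<delta> \<subseteq> f ` ball 0 (\<rho> N)"
      using open_contains_ball by blast
    moreover have "f ` ball 0 (\<rho> N) \<subseteq> f ` cball 0 (\<rho> n)" if "n \<ge> N" for n
      using \<rho>_mono[OF that] by (intro image_mono) auto
    ultimately show ?thesis
      by blast
  qed
  then obtain d where "is_half_line_field (- f ` unit_disc) d"
    using half_line_field_limit[of "\<lambda>n. f ` cball 0 (\<rho> n)" e "f ` unit_disc"] e cball_sub by (metis image_mono)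
  moreover have "open (f ` unit_disc)"
    by (rule open_f) simp
  moreover have "connected (f ` unit_disc)"
    by (intro connected_continuous_image contf convex_connected convex_ball)
  ultimately have "close_to_convex_domain (f ` unit_disc)"
    unfolding close_to_convex_domain_def using half_lines_of_field[of "- f ` unit_disc" d]
    by (auto simp: closed_open)
  with inj show ?thesis
    by (simp add: close_to_convex_def)
qed

end

section \<open>The starlike function of the class\<close>

text \<open>
  The function \<open>\<phi> z / z\<close> has no zeros once the singularity at 0 is removed, so it has a logarithm \<open>l\<close>,
  normalized by \<open>\<phi>'(0) = 1\<close> to vanish at 0; then \<open>z \<phi>' / \<phi> = 1 + z l'\<close>.
\<close>
lemma starlike_exponent_exists:
  assumes \<phi>: "\<phi> \<in> starlike_of_order \<beta>" and "\<beta> < 1"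
  obtains l where "l holomorphic_on unit_disc" "l 0 = 0"
    and "\<And>z. z \<in> unit_disc \<Longrightarrow> \<phi> z = z * exp (l z)"
    and "\<And>z. z \<in> unit_disc \<Longrightarrow> Re (1 + z * deriv l z) > \<beta>"
proof -
  have \<phi>_hol: "\<phi> holomorphic_on unit_disc" and \<phi>0: "\<phi> 0 = 0" "deriv \<phi> 0 = 1"
    and \<phi>_nz: "\<And>z. z \<in> unit_disc - {0} \<Longrightarrow> \<phi> z \<noteq> 0"
    and \<phi>_Re: "\<And>z. z \<in> unit_disc - {0} \<Longrightarrow> Re (z * deriv \<phi> z / \<phi> z) > \<beta>"
    using \<phi> by (auto simp: starlike_of_order_def)
  define q where "q = (\<lambda>z. if z = 0 then deriv \<phi> 0 else (\<phi> z - \<phi> 0) / (z - 0))"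
  have q: "\<phi> z = z * q z" for z
    by (simp add: q_def \<phi>0)
  have q_hol: "q holomorphic_on unit_disc"
    unfolding q_def by (rule pole_lemma[OF \<phi>_hol]) (simp add: interior_open)
  have q_nz: "q z \<noteq> 0" if "z \<in> unit_disc" for z
  proof (cases "z = 0")
    case True
    then show ?thesis
      by (simp add: q_def \<phi>0)
  next
    case False
    then show ?thesis
      using \<phi>_nz[of z] that q[of z] by auto
  qed
  obtain l0 where l0: "l0 holomorphic_on unit_disc" "\<And>z. z \<in> unit_disc \<Longrightarrow> exp (l0 z) = q z"
    using holomorphic_logarithm_exists[OF convex_ball open_ball q_hol q_nz, of 0] by auto
  define l where "l = (\<lambda>z. l0 z - l0 0)"
  have l_hol: "l holomorphic_on unit_disc"
    unfolding l_def by (intro holomorphic_intros l0)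
  have "exp (l0 0) = 1"
    using l0(2)[of 0] by (simp add: q_def \<phi>0)
  then have \<phi>_eq: "\<phi> z = z * exp (l z)" if "z \<in> unit_disc" for z
    using l0(2)[OF that] q[of z] by (simp add: l_def exp_diff)
  have "Re (1 + z * deriv l z) > \<beta>" if z: "z \<in> unit_disc" for z
  proof (cases "z = 0")
    case False
    have "((\<lambda>z. z * exp (l z)) has_field_derivative exp (l z) + z * (exp (l z) * deriv l z)) (at z)"
      using holomorphic_derivI[OF l_hol open_ball z] by (auto intro!: derivative_eq_intros)
    then have "(\<phi> has_field_derivative exp (l z) + z * (exp (l z) * deriv l z)) (at z)"
      by (rule has_field_derivative_transform_within_open[OF _ open_ball z]) (simp add: \<phi>_eq)
    then have "deriv \<phi> z = exp (l z) + z * (exp (l z) * deriv l z)"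
      by (rule DERIV_imp_deriv)
    then have "z * deriv \<phi> z / \<phi> z = 1 + z * deriv l z"
      using False \<phi>_eq[OF z] by (simp add: field_simps)
    then show ?thesis
      using \<phi>_Re[of z] z False by simp
  qed (use \<open>\<beta> < 1\<close> in simp)
  with l_hol \<phi>_eq show thesis
    by (intro that[of l]) (auto simp: l_def)
qed

text \<open>
  With \<open>\<phi> z = z exp (l z)\<close>, the factors of \<open>phi_k\<close> multiply to \<open>z\<^sup>k exp (M z)\<close>, where \<open>M z\<close> is the sum of
  the \<open>l (\<mu>\<^sup>j z)\<close>. The order \<open>(k - 1) / k\<close> says that \<open>Re (z l'(z)) > - 1 / k\<close>, and the \<open>k\<close> summands of
  \<open>z M'(z)\<close> thus have real parts whose sum exceeds \<open>- 1\<close>.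
\<close>
lemma quot_k_exponent:
  assumes "k > 0" and \<phi>: "\<phi> \<in> starlike_of_order ((real k - 1) / real k)"
  obtains M where "starlike_exponent M" and "\<And>z. z \<in> unit_disc \<Longrightarrow> quot_k k \<phi> z = exp (- M z)"
proof -
  have "(real k - 1) / real k < 1"
    using assms by (simp add: field_simps)
  then obtain l where l: "l holomorphic_on unit_disc" "l 0 = 0"
    and \<phi>_eq: "\<And>z. z \<in> unit_disc \<Longrightarrow> \<phi> z = z * exp (l z)"
    and l_Re: "\<And>z. z \<in> unit_disc \<Longrightarrow> Re (1 + z * deriv l z) > (real k - 1) / real k"
    using starlike_exponent_exists[OF \<phi>] by metis
  define \<mu> where "\<mu> = root_mu k"
  have \<mu>: "norm \<mu> = 1" "\<mu> \<noteq> 0"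
    by (simp_all add: \<mu>_def root_mu_def norm_exp_eq_Re)
  have in_disc: "\<mu> ^ j * z \<in> unit_disc" if "z \<in> unit_disc" for j z
    using that by (simp add: norm_mult norm_power \<mu>)
  define M where "M = (\<lambda>z. \<Sum>j<k. l (\<mu> ^ j * z))"
  have M': "(M has_field_derivative (\<Sum>j<k. deriv l (\<mu> ^ j * z) * \<mu> ^ j)) (at z)" if "z \<in> unit_disc" for z
    unfolding M_def
  proof (rule DERIV_sum)
    fix j
    show "((\<lambda>z. l (\<mu> ^ j * z)) has_field_derivative deriv l (\<mu> ^ j * z) * \<mu> ^ j) (at z)"
      by (rule DERIV_chain2[OF holomorphic_derivI[OF l(1) open_ball in_disc[OF that]] DERIV_cmult_Id])
  qed
  have "starlike_exponent M"
  proof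
    show "M holomorphic_on unit_disc"
      unfolding holomorphic_on_open[OF open_ball] using M' by blast
    fix z :: complex assume z: "z \<in> unit_disc"
    have "- (\<Sum>j<k. 1 / real k) < (\<Sum>j<k. Re (\<mu> ^ j * z * deriv l (\<mu> ^ j * z)))"
      unfolding sum_negf[symmetric]
    proof (rule sum_strict_mono)
      fix j
      show "- (1 / real k) < Re (\<mu> ^ j * z * deriv l (\<mu> ^ j * z))"
        using l_Re[OF in_disc[OF z, of j]] assms by (simp add: diff_divide_distrib)
    qed (use assms in auto)
    also have "(\<Sum>j<k. Re (\<mu> ^ j * z * deriv l (\<mu> ^ j * z))) = Re (z * deriv M z)"
      unfolding DERIV_imp_deriv[OF M'[OF z]] sum_distrib_left Re_sum[symmetric]
      by (intro arg_cong[of _ _ Re] sum.cong) (auto simp: algebra_simps)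
    finally show "Re (1 + z * deriv M z) > 0"
      using assms by simp
  qed
  moreover have "quot_k k \<phi> z = exp (- M z)" if z: "z \<in> unit_disc" for z
  proof (cases "z = 0")
    case False
    have "phi_k k \<phi> z = (\<Prod>j<k. z * exp (l (\<mu> ^ j * z)))"
      unfolding phi_k_def \<mu>_def[symmetric]
      by (intro prod.cong) (auto simp: \<phi>_eq[OF in_disc[OF z]] \<mu>)
    also have "\<dots> = z ^ k * exp (M z)"
      by (simp add: prod.distrib M_def exp_sum)
    finally show ?thesis
      using False by (simp add: quot_k_def exp_minus field_simps)
  qed (simp add: quot_k_def M_def l)
  ultimately show thesis
    by (rule that)
qed

theorem theorem3p5:
  fixes k :: nat and \<gamma> :: real and \<phi> f :: "complex \<Rightarrow> complex"
  assumes "k > 0"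
    and "0 \<le> \<gamma>" and "\<gamma> < 1"
    and "\<phi> \<in> starlike_of_order ((real k - 1) / real k)"
    and "f \<in> KH0 k \<gamma> \<phi>"
  shows "close_to_convex f"
proof -
  obtain u v where uv: "canonical_decomp f u v"
    and dom: "\<And>z. z \<in> unit_disc \<Longrightarrow>
      Re (quot_k k \<phi> z * deriv u z - of_real \<gamma>) > cmod (quot_k k \<phi> z * deriv v z)"
    using \<open>f \<in> KH0 k \<gamma> \<phi>\<close> unfolding KH0_def by blast
  obtain M where M: "starlike_exponent M" "\<And>z. z \<in> unit_disc \<Longrightarrow> quot_k k \<phi> z = exp (- M z)"
    using quot_k_exponent[OF assms(1,4)] by blast
  obtain g where g: "\<And>z. z \<in> unit_disc \<Longrightarrow> (g has_field_derivative exp (M z)) (at z within unit_disc)"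
    using holomorphic_convex_primitive'[of unit_disc "\<lambda>z. exp (M z)"] M(1)
    by (auto simp: starlike_exponent_def intro!: holomorphic_intros)
  interpret convex_primitive M g
    unfolding convex_primitive_def convex_primitive_axioms_def
    using M(1) g at_within_open[OF _ open_ball] by metis
  show ?thesis
  proof (rule close_to_convex_if_dominated)
    show "cmod (exp (- M z) * deriv v z) < Re (exp (- M z) * deriv u z)" if "z \<in> unit_disc" for z
      using dom[OF that] M(2)[OF that] \<open>0 \<le> \<gamma>\<close> by simp
  qed (use uv in \<open>auto simp: canonical_decomp_def\<close>)
qed

end
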